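(* If $G$ is a complete cubic Halin graph, then $\chi'_{st}(G)=5$.
   Context: All graphs are finite and simple. For $k\ge 1$ let $[k]=\{1,2,\dots,k\}$. A star $k$-edge coloring of a graph $G$ is a proper edge-coloring $c:E(G)\to[k]$ such that no path of length four (four edges) and no cycle of length four in $G$ is bi-colored (i.e. uses only two colors) under $c$. The star chromatic index $\chi'_{st}(G)$ is the smallest integer $k$ such that $G$ admits a star $k$-edge coloring. A Halin graph $G=T\cup C$ is a planar graph that consists of a plane embedding of a tree $T$ that has no vertices of degree two, together with a cycle $C$ connecting all the leaves of $T$ such that $C$ is the boundary of the exterior face. The tree $T$ is called the characteristic tree. If every non-leaf vertex of $T$ has degree exactly $3$ in $T$, then $G$ is called a cubic Halin graph. For $l\ge 1$, a complete tree $T_l$ (with $l$ levels) is a tree with a root vertex $v_0$ such that all its leaves are at the same distance $l$ from $v_0$. A complete cubic Halin graph is a cubic Halin graph whose characteristic tree is a complete tree $T_l$ for some $l\ge 1$; it is denoted by $G_l$ (so every non-leaf vertex of $T_l$, including the root, has degree $3$; in particular $G_1\cong K_4$). *)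

theory Defs
  imports "HOL-Analysis.Analysis"
begin

text \<open>
  A graph is given by its vertex set \<open>V\<close> and its set \<open>E\<close> of edges, an edge being the
  two-element set of its end vertices. Paths and cycles are given by their lists of (distinct)
  vertices, so a path with \<open>n\<close> edges is a list of length \<open>Suc n\<close>, a cycle with \<open>n\<close> edges a list of
  length \<open>n\<close>.
\<close>

definition simple_graph :: "'a set \<Rightarrow> 'a set set \<Rightarrow> bool" where
  "simple_graph V E \<longleftrightarrow> finite V \<and> (\<forall>e\<in>E. e \<subseteq> V \<and> card e = 2)"

definition path_edges :: "'a list \<Rightarrow> 'a set set" where
  "path_edges xs = {{xs ! i, xs ! Suc i} | i. Suc i < length xs}"

definition cycle_edges :: "'a list \<Rightarrow> 'a set set" where
  "cycle_edges xs = insert {last xs, hd xs} (path_edges xs)"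

definition graph_path :: "'a set \<Rightarrow> 'a set set \<Rightarrow> 'a list \<Rightarrow> bool" where
  "graph_path V E xs \<longleftrightarrow> xs \<noteq> [] \<and> distinct xs \<and> set xs \<subseteq> V \<and> path_edges xs \<subseteq> E"

definition graph_cycle :: "'a set \<Rightarrow> 'a set set \<Rightarrow> 'a list \<Rightarrow> bool" where
  "graph_cycle V E xs \<longleftrightarrow> length xs \<ge> 3 \<and> distinct xs \<and> set xs \<subseteq> V \<and> cycle_edges xs \<subseteq> E"

definition graph_connected :: "'a set \<Rightarrow> 'a set set \<Rightarrow> bool" where
  "graph_connected V E \<longleftrightarrow> V \<noteq> {} \<and>
     (\<forall>u\<in>V. \<forall>v\<in>V. \<exists>xs. graph_path V E xs \<and> hd xs = u \<and> last xs = v)"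

definition graph_dist :: "'a set \<Rightarrow> 'a set set \<Rightarrow> 'a \<Rightarrow> 'a \<Rightarrow> nat" where
  "graph_dist V E u v =
     (LEAST n. \<exists>xs. graph_path V E xs \<and> hd xs = u \<and> last xs = v \<and> length xs = Suc n)"

definition degree :: "'a set set \<Rightarrow> 'a \<Rightarrow> nat" where
  "degree E v = card {e \<in> E. v \<in> e}"

definition tree :: "'a set \<Rightarrow> 'a set set \<Rightarrow> bool" where
  "tree V T \<longleftrightarrow> simple_graph V T \<and> graph_connected V T \<and> (\<nexists>xs. graph_cycle V T xs)"

definition leaves :: "'a set \<Rightarrow> 'a set set \<Rightarrow> 'a set" where
  "leaves V T = {v \<in> V. degree T v = 1}"


subsection \<open>Star edge colorings\<close>

definition proper_edge_coloring :: "'a set set \<Rightarrow> nat \<Rightarrow> ('a set \<Rightarrow> nat) \<Rightarrow> bool" where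
  "proper_edge_coloring E k c \<longleftrightarrow>
     c ` E \<subseteq> {1..k} \<and> (\<forall>e\<in>E. \<forall>f\<in>E. e \<noteq> f \<and> e \<inter> f \<noteq> {} \<longrightarrow> c e \<noteq> c f)"

definition bicolored :: "('a set \<Rightarrow> nat) \<Rightarrow> 'a set set \<Rightarrow> bool" where
  "bicolored c S \<longleftrightarrow> card (c ` S) = 2"

definition star_edge_coloring ::
  "'a set \<Rightarrow> 'a set set \<Rightarrow> nat \<Rightarrow> ('a set \<Rightarrow> nat) \<Rightarrow> bool" where
  "star_edge_coloring V E k c \<longleftrightarrow>
     proper_edge_coloring E k c \<and>
     (\<forall>xs. graph_path V E xs \<and> length xs = 5 \<longrightarrow> \<not> bicolored c (path_edges xs)) \<and>
     (\<forall>xs. graph_cycle V E xs \<and> length xs = 4 \<longrightarrow> \<not> bicolored c (cycle_edges xs))"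

definition star_chromatic_index :: "'a set \<Rightarrow> 'a set set \<Rightarrow> nat" where
  "star_chromatic_index V E = (LEAST k. k \<ge> 1 \<and> (\<exists>c. star_edge_coloring V E k c))"


subsection \<open>Plane embeddings and Halin graphs\<close>

text \<open>
  An embedding in the plane \<open>\<complex>\<close> sends the vertices to distinct points (\<open>p\<close>) and each edge to an arc
  (\<open>\<gamma>\<close>) joining its end points; arcs contain no further vertices and meet only in common end points.
\<close>

definition plane_embedding ::
  "'a set \<Rightarrow> 'a set set \<Rightarrow> ('a \<Rightarrow> complex) \<Rightarrow> ('a set \<Rightarrow> real \<Rightarrow> complex) \<Rightarrow> bool" where
  "plane_embedding V E p \<gamma> \<longleftrightarrow>
     inj_on p V \<and>
     (\<forall>e\<in>E. arc (\<gamma> e) \<and> {pathstart (\<gamma> e), pathfinish (\<gamma> e)} = p ` e) \<and>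
     (\<forall>e\<in>E. \<forall>v\<in>V. p v \<in> path_image (\<gamma> e) \<longrightarrow> v \<in> e) \<and>
     (\<forall>e\<in>E. \<forall>f\<in>E. e \<noteq> f \<longrightarrow> path_image (\<gamma> e) \<inter> path_image (\<gamma> f) \<subseteq> p ` (e \<inter> f))"

definition edges_image :: "('a set \<Rightarrow> real \<Rightarrow> complex) \<Rightarrow> 'a set set \<Rightarrow> complex set" where
  "edges_image \<gamma> E = (\<Union>e\<in>E. path_image (\<gamma> e))"

text \<open>
  The drawing of a finite graph is compact, so its complement has exactly one unbounded component;
  \<^const>\<open>outside\<close> is that component.
\<close>

definition exterior_face ::
  "'a set \<Rightarrow> 'a set set \<Rightarrow> ('a \<Rightarrow> complex) \<Rightarrow> ('a set \<Rightarrow> real \<Rightarrow> complex) \<Rightarrow> complex set" where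
  "exterior_face V E p \<gamma> = outside (p ` V \<union> edges_image \<gamma> E)"

text \<open>
  \<open>T\<close> and \<open>C\<close> are the edge sets of the characteristic tree and of the cycle through its leaves;
  the tree spans all of \<open>V\<close>.
\<close>

definition halin_graph :: "'a set \<Rightarrow> 'a set set \<Rightarrow> 'a set set \<Rightarrow> 'a set set \<Rightarrow> bool" where
  "halin_graph V E T C \<longleftrightarrow>
     tree V T \<and> (\<forall>v\<in>V. degree T v \<noteq> 2) \<and>
     (\<exists>xs. graph_cycle V C xs \<and> set xs = leaves V T \<and> C = cycle_edges xs) \<and>
     E = T \<union> C \<and>
     (\<exists>p \<gamma>. plane_embedding V E p \<gamma> \<and> frontier (exterior_face V E p \<gamma>) = edges_image \<gamma> C)"

definition cubic_halin_graph :: "'a set \<Rightarrow> 'a set set \<Rightarrow> 'a set set \<Rightarrow> 'a set set \<Rightarrow> bool" where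
  "cubic_halin_graph V E T C \<longleftrightarrow>
     halin_graph V E T C \<and> (\<forall>v \<in> V - leaves V T. degree T v = 3)"

definition complete_tree :: "'a set \<Rightarrow> 'a set set \<Rightarrow> nat \<Rightarrow> bool" where
  "complete_tree V T l \<longleftrightarrow>
     l \<ge> 1 \<and> tree V T \<and> (\<exists>r\<in>V. \<forall>v \<in> leaves V T. graph_dist V T r v = l)"

definition complete_cubic_halin_graph :: "'a set \<Rightarrow> 'a set set \<Rightarrow> bool" where
  "complete_cubic_halin_graph V E \<longleftrightarrow>
     (\<exists>T C l. cubic_halin_graph V E T C \<and> complete_tree V T l)"

end

theory Submission
  imports Defs
begin

text \<open>
  In a proper edge coloring, a bicolored path with four edges, or a bicolored 4-cycle, alternates
  between its two colors. Seen from its middle vertex \<open>v\<close> it consists of two neighbors \<open>u\<close> and \<open>w\<close>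
  of \<open>v\<close> such that the color of \<open>vw\<close> occurs at \<open>u\<close> and the color of \<open>vu\<close> occurs at \<open>w\<close>. Being a star
  edge coloring is therefore a condition on the colors around each vertex and around its neighbors
  (\<open>star_edge_coloring_pair\<close>, \<open>star_edge_coloringI\<close>), and both bounds use it in this form.

  At least five colors. With four colors, every vertex of a cubic graph misses exactly one of them,
  and the condition says which colors neighbors may miss. This is contradictory around a triangle
  (\<open>star_edge_coloring_triangle_ge_5\<close>), and two sibling leaves that are consecutive on the cycle form
  a triangle with their parent.

  At most five colors. Up to isomorphism there is only one complete cubic Halin graph with \<open>l\<close> levels:
  the leaves are numbered along the cycle, and the node number \<open>i\<close> at height \<open>k\<close> is the ancestor of
  the leaves \<open>j\<close> with \<open>j div 2 ^ k = i\<close>. This is where the plane embedding enters. The cycle is a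
  Jordan curve, and since it is the frontier of the exterior face the tree is drawn inside it. Two
  disjoint tree paths between leaves are then disjoint chords of a disc, so their ends do not
  interleave on the cycle (\<open>no_crossing_chords\<close>, \<open>no_interleaving\<close>). Hence the leaves below a vertex
  form an interval of the cycle. All vertices of the same height have equally many leaves below them,
  so these intervals are the blocks of a regular subdivision (\<open>anc_convex\<close>, \<open>anc_eq_iff\<close>), which
  gives the coordinates \<open>(k, i)\<close> (\<open>complete_cubic_halin_coordinates\<close>).

  In coordinates the coloring is explicit. The color of the edge above the node \<open>(k, i)\<close> depends on
  \<open>i mod 12\<close> only, and three levels higher the same colors return with 1 and 2 exchanged; the cycle
  edges also have period 12, which closes up because \<open>12\<close> divides the number \<open>3 * 2 ^ (l - 1)\<close> of
  leaves as soon as \<open>l \<ge> 3\<close>. So only finitely many local configurations occur, and each of them is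
  checked. For \<open>l = 2\<close> the same words work, and \<open>l = 1\<close> is the graph \<open>K\<^sub>4\<close>.
\<close>

section \<open>Paths and cycles as lists\<close>

lemma simple_graph_edgeD:
  assumes "simple_graph V E" "{u, v} \<in> E"
  shows "u \<noteq> v" "u \<in> V" "v \<in> V"
  using assms unfolding simple_graph_def by fastforce+

lemma path_edges_Nil [simp]: "path_edges [] = {}"
  and path_edges_single [simp]: "path_edges [x] = {}"
  by (auto simp: path_edges_def)

lemma path_edges_Cons_Cons [simp]:
  "path_edges (x # y # zs) = insert {x, y} (path_edges (y # zs))"
proof -
  have "path_edges (x # y # zs) = (\<lambda>i. {(x # y # zs) ! i, (y # zs) ! i}) ` {i. i < Suc (length zs)}"
    by (auto simp: path_edges_def)
  also have "{i. i < Suc (length zs)} = insert 0 (Suc ` {i. i < length zs})"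
    by (auto simp: image_iff less_Suc_eq_0_disj)
  also have "(\<lambda>i. {(x # y # zs) ! i, (y # zs) ! i}) ` \<dots> = insert {x, y} (path_edges (y # zs))"
    by (auto simp: path_edges_def image_image)
  finally show ?thesis .
qed

lemma path_edges_append:
  "xs \<noteq> [] \<Longrightarrow> ys \<noteq> [] \<Longrightarrow>
    path_edges (xs @ ys) = insert {last xs, hd ys} (path_edges xs \<union> path_edges ys)"
proof (induction xs rule: induct_list012)
  case (2 x)
  then show ?case by (cases ys) auto
qed auto

lemma path_edge_subset: "e \<in> path_edges xs \<Longrightarrow> e \<subseteq> set xs"
  by (auto simp: path_edges_def)

lemma Union_path_edges: "length xs \<ge> 2 \<Longrightarrow> \<Union>(path_edges xs) = set xs"
proof (induction xs rule: induct_list012)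
  case (3 x y zs)
  then show ?case by (cases zs) auto
qed auto

lemma path_edge_meets_interior:
  "us \<noteq> [] \<Longrightarrow> e \<in> path_edges (x # us @ [y]) \<Longrightarrow> e \<inter> set us \<noteq> {}"
  by (induction us arbitrary: x rule: induct_list012) auto

lemma cycle_edges_split:
  "cycle_edges (x # us @ y # ws) = path_edges (x # us @ [y]) \<union> path_edges (y # ws @ [x])"
proof -
  have "path_edges (x # us @ y # ws) = path_edges (x # us @ [y]) \<union> path_edges (y # ws)"
    using path_edges_append[of "x # us" "y # ws"] path_edges_append[of "x # us" "[y]"] by auto
  moreover have "path_edges (y # ws @ [x]) = insert {last (y # ws), x} (path_edges (y # ws))"
    using path_edges_append[of "y # ws" "[x]"] by auto
  ultimately show ?thesis by (auto simp: cycle_edges_def)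
qed

lemma cycle_edges_append_commute: "cycle_edges (xs @ ys) = cycle_edges (ys @ xs)"
proof (cases "xs = [] \<or> ys = []")
  case False
  then show ?thesis using path_edges_append[of xs ys] path_edges_append[of ys xs]
    by (auto simp: cycle_edges_def)
qed auto

lemma graph_cycle_append_commute: "graph_cycle V E (xs @ ys) \<longleftrightarrow> graph_cycle V E (ys @ xs)"
  using cycle_edges_append_commute[of xs ys] by (auto simp: graph_cycle_def)

section \<open>Star colorings seen from the middle vertex of a path\<close>

text \<open>
  The colors alternate along \<open>x, u, v, w, y\<close>, which is a path with four edges, or a 4-cycle if \<open>x = y\<close>;
  properness excludes all other coincidences.
\<close>

lemma star_edge_coloring_pair:
  assumes G: "simple_graph V E" and c: "star_edge_coloring V E k c"
    and E: "{v, u} \<in> E" "{v, w} \<in> E" "{u, x} \<in> E" "{w, y} \<in> E" and uw: "u \<noteq> w"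
    and eq: "c {u, x} = c {v, w}" "c {w, y} = c {v, u}"
  shows False
proof -
  have adj: "e \<noteq> f \<Longrightarrow> e \<inter> f \<noteq> {} \<Longrightarrow> c e \<noteq> c f" if "e \<in> E" "f \<in> E" for e f
    using c that unfolding star_edge_coloring_def proper_edge_coloring_def by blast
  note ne = simple_graph_edgeD[OF G]
  have uvw: "c {v, u} \<noteq> c {v, w}" using adj[OF E(1,2)] uw by (auto simp: doubleton_eq_iff)
  have x: "x \<noteq> v" "x \<noteq> u" using uvw eq ne[OF E(3)] by (auto simp: insert_commute)
  have y: "y \<noteq> v" "y \<noteq> w" using uvw eq ne[OF E(4)] by (auto simp: insert_commute)
  have xw: "x \<noteq> w"
    using adj[OF E(3,2)] eq x uw ne[OF E(1)] by (auto simp: doubleton_eq_iff)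
  have yu: "y \<noteq> u"
    using adj[OF E(4,1)] eq y uw ne[OF E(2)] by (auto simp: doubleton_eq_iff)
  have two: "card {c {u, x}, c {v, u}} = 2" using uvw eq by simp
  have V: "{x, u, v, w, y} \<subseteq> V" using ne[OF E(1)] ne[OF E(2)] ne[OF E(3)] ne[OF E(4)] by auto
  show False
  proof (cases "x = y")
    case True
    have "graph_cycle V E [x, u, v, w]"
      using V E x y xw yu uw ne[OF E(1)] ne[OF E(2)] True
      by (auto simp: graph_cycle_def cycle_edges_def insert_commute)
    moreover have "bicolored c (cycle_edges [x, u, v, w])"
      using two eq True by (auto simp: bicolored_def cycle_edges_def insert_commute)
    ultimately show False using c unfolding star_edge_coloring_def by fastforce
  next
    case False
    have "graph_path V E [x, u, v, w, y]"
      using V E x y xw yu uw ne[OF E(1)] ne[OF E(2)] False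
      by (auto simp: graph_path_def insert_commute)
    moreover have "bicolored c (path_edges [x, u, v, w, y])"
      using two eq by (auto simp: bicolored_def insert_commute)
    ultimately show False using c unfolding star_edge_coloring_def by fastforce
  qed
qed

text \<open>
  Two colors on four consecutive edges of a path or of a 4-cycle must alternate, so the condition
  \<open>pair\<close> is violated at the middle vertex; in a 4-cycle every vertex is a middle vertex, with \<open>x = y\<close>.
\<close>

lemma star_edge_coloringI:
  assumes G: "simple_graph V E" and range: "c ` E \<subseteq> {1..k}"
    and proper: "\<And>v u w. {v, u} \<in> E \<Longrightarrow> {v, w} \<in> E \<Longrightarrow> u \<noteq> w \<Longrightarrow> c {v, u} \<noteq> c {v, w}"
    and pair: "\<And>v u w x y. {v, u} \<in> E \<Longrightarrow> {v, w} \<in> E \<Longrightarrow> u \<noteq> w \<Longrightarrow> {u, x} \<in> E \<Longrightarrow> {w, y} \<in> E \<Longrightarrow>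
      c {u, x} = c {v, w} \<Longrightarrow> c {w, y} = c {v, u} \<Longrightarrow> False"
  shows "star_edge_coloring V E k c"
proof -
  have alternate: False
    if e: "{x, u} \<in> E" "{u, v} \<in> E" "{v, w} \<in> E" "{w, y} \<in> E" and ne: "x \<noteq> v" "u \<noteq> w" "v \<noteq> y"
      and two: "card {c {x, u}, c {u, v}, c {v, w}, c {w, y}} = 2" for x u v w y
  proof -
    have 1: "c {x, u} \<noteq> c {u, v}" using proper[of u x v] e ne by (auto simp: insert_commute)
    have 2: "c {u, v} \<noteq> c {v, w}" using proper[of v u w] e ne by (auto simp: insert_commute)
    have 3: "c {v, w} \<noteq> c {w, y}" using proper[of w v y] e ne by (auto simp: insert_commute)
    obtain a b where ab: "{c {x, u}, c {u, v}, c {v, w}, c {w, y}} = {a, b}"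
      using two by (auto simp: card_2_iff)
    have "c {x, u} \<in> {a, b}" "c {u, v} \<in> {a, b}" "c {v, w} \<in> {a, b}" "c {w, y} \<in> {a, b}"
      by (auto simp flip: ab)
    with 1 2 3 have "c {x, u} = c {v, w}" "c {w, y} = c {u, v}" by auto
    with pair[of v u w x y] e ne show False by (auto simp: insert_commute)
  qed
  have edge: "\<exists>a b. e = {a, b}" if "e \<in> E" for e
    using G that unfolding simple_graph_def by (meson card_2_iff)
  have "proper_edge_coloring E k c"
    unfolding proper_edge_coloring_def
  proof (intro conjI ballI impI range)
    fix e f assume *: "e \<in> E" "f \<in> E" "e \<noteq> f \<and> e \<inter> f \<noteq> {}"
    obtain a b where e: "e = {a, b}" using edge[OF *(1)] by blast
    obtain a' b' where f: "f = {a', b'}" using edge[OF *(2)] by blast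
    from * have "\<exists>v u w. e = {v, u} \<and> f = {v, w} \<and> u \<noteq> w" unfolding e f
      by (auto simp: doubleton_eq_iff)
    then show "c e \<noteq> c f" using proper * by blast
  qed
  moreover have False
    if p: "graph_path V E xs" "length xs = 5" and b: "bicolored c (path_edges xs)" for xs
  proof -
    obtain x u v w y where xs: "xs = [x, u, v, w, y]"
      using p(2) by (auto simp: numeral_eq_Suc length_Suc_conv)
    show False
      using alternate[of x u v w y] p(1) b by (auto simp: xs graph_path_def bicolored_def)
  qed
  moreover have False
    if p: "graph_cycle V E xs" "length xs = 4" and b: "bicolored c (cycle_edges xs)" for xs
  proof -
    obtain u v w x where xs: "xs = [u, v, w, x]"
      using p(2) by (auto simp: numeral_eq_Suc length_Suc_conv)
    show False
      using alternate[of x u v w x] p(1) b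
      by (auto simp: xs graph_cycle_def cycle_edges_def bicolored_def insert_commute)
  qed
  ultimately show ?thesis unfolding star_edge_coloring_def by blast
qed

section \<open>No star 4-edge coloring with a triangle\<close>

text \<open>
  With at most four colors each vertex \<open>v\<close> misses exactly one color \<open>m v\<close> of \<open>1, \<dots>, 4\<close>, and the star
  condition at \<open>v\<close> reads \<open>m u = c {v, w} \<or> m w = c {v, u}\<close>. Applied to the sides of the triangle it
  shows that at least two corners, say \<open>x\<close> and \<open>y\<close>, miss the color of the opposite side. The conditions
  that involve the outer edges at \<open>x\<close> and \<open>y\<close> then make both outer edges have color \<open>m z\<close>, and the
  conditions at \<open>z\<close> make the outer neighbor \<open>z'\<close> miss the colors of both sides at \<open>z\<close>.
\<close>

lemma star_edge_coloring_triangle_ge_5: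
  assumes G: "simple_graph V E" and c: "star_edge_coloring V E k c"
    and deg: "\<And>v. v \<in> V \<Longrightarrow> degree E v = 3"
    and tri: "{x, y} \<in> E" "{y, z} \<in> E" "{z, x} \<in> E"
  shows "k \<ge> 5"
proof (rule ccontr)
  assume "\<not> k \<ge> 5"
  note ne = simple_graph_edgeD[OF G]
  define P where "P v = c ` {e \<in> E. v \<in> e}" for v
  have proper: "c e \<noteq> c f" if "e \<in> E" "f \<in> E" "e \<noteq> f" "e \<inter> f \<noteq> {}" for e f
    using c that unfolding star_edge_coloring_def proper_edge_coloring_def by blast
  have rng: "c e \<in> {1,2,3,4}" if "e \<in> E" for e
  proof -
    have "c e \<in> {1..k}" using c that unfolding star_edge_coloring_def proper_edge_coloring_def by blast
    with \<open>\<not> k \<ge> 5\<close> show ?thesis by auto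
  qed
  have "\<exists>m. P v = {1,2,3,4} - {m} \<and> m \<in> {1,2,3,4}" if v: "v \<in> V" for v
  proof -
    have "inj_on c {e \<in> E. v \<in> e}" using proper by (auto intro!: inj_onI)
    then have "card (P v) = 3" using deg[OF v] unfolding P_def degree_def by (simp add: card_image)
    moreover have sub: "P v \<subseteq> {1,2,3,4}" using rng by (auto simp: P_def)
    ultimately have "card ({1,2,3,4} - P v) = 1" by (subst card_Diff_subset) (auto intro: finite_subset)
    then obtain m where "{1,2,3,4} - P v = {m}" by (auto simp: card_1_singleton_iff)
    then show ?thesis using sub by (intro exI[of _ m]) blast
  qed
  then obtain m where m: "\<And>v. v \<in> V \<Longrightarrow> P v = {1,2,3,4} - {m v} \<and> m v \<in> {1,2,3,4}" by metis
  have pair: "m u = c {v, w} \<or> m w = c {v, u}"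
    if e: "{v, u} \<in> E" "{v, w} \<in> E" "u \<noteq> w" for u v w
  proof (rule ccontr)
    assume "\<not> ?thesis"
    then have "c {v, w} \<in> P u" "c {v, u} \<in> P w" using m rng e ne[OF e(1)] ne[OF e(2)] by auto
    then obtain f g where f: "f \<in> E" "u \<in> f" "c f = c {v, w}" and g: "g \<in> E" "w \<in> g" "c g = c {v, u}"
      by (auto simp: P_def)
    have "\<exists>s. f = {u, s}" "\<exists>t. g = {w, t}"
      using f g G unfolding simple_graph_def by (metis card_2_iff insertE insert_commute singletonD)+
    then show False using star_edge_coloring_pair[OF G c] e f g by metis
  qed
  have third: "\<exists>t. {v, t} \<in> E \<and> t \<noteq> a \<and> t \<noteq> b" if "v \<in> V" for v a b
  proof (rule ccontr)
    assume *: "\<not> ?thesis"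
    have "e \<in> {{v, a}, {v, b}}" if e: "e \<in> E" "v \<in> e" for e
    proof -
      obtain t where "e = {v, t}"
        using e G unfolding simple_graph_def by (metis card_2_iff insertE insert_commute singletonD)
      then show ?thesis using * e by auto
    qed
    then have "{e \<in> E. v \<in> e} \<subseteq> {{v, a}, {v, b}}" by blast
    from card_mono[OF _ this] have "degree E v \<le> card {{v, a}, {v, b}}" by (simp add: degree_def)
    also have "\<dots> \<le> 2" by (simp add: card_insert_if)
    finally show False using deg[OF that] by simp
  qed
  have V: "x \<in> V" "y \<in> V" "z \<in> V" and d: "x \<noteq> y" "y \<noteq> z" "z \<noteq> x"
    using ne[OF tri(1)] ne[OF tri(2)] ne[OF tri(3)] by auto
  have tri': "{y, x} \<in> E" "{z, y} \<in> E" "{x, z} \<in> E" using tri by (auto simp: insert_commute)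
  obtain x' where x': "{x, x'} \<in> E" "x' \<noteq> y" "x' \<noteq> z" using third[OF V(1)] by blast
  obtain y' where y': "{y, y'} \<in> E" "y' \<noteq> x" "y' \<noteq> z" using third[OF V(2)] by blast
  obtain z' where z': "{z, z'} \<in> E" "z' \<noteq> x" "z' \<noteq> y" using third[OF V(3)] by blast
  have sym: "c {y, x} = c {x, y}" "c {z, y} = c {y, z}" "c {x, z} = c {z, x}"
    by (auto simp: insert_commute)
  have in_P: "c {v, u} \<noteq> m v" if "{v, u} \<in> E" for v u
    using m[of v] ne[OF that] that unfolding P_def by blast
  note proper_at = proper[OF tri(1,2)] proper[OF tri(2,3)] proper[OF tri(3,1)]
    proper[OF x'(1) tri(1)] proper[OF x'(1) tri(3)] proper[OF y'(1) tri(1)] proper[OF y'(1) tri(2)]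
    proper[OF z'(1) tri(2)] proper[OF z'(1) tri(3)]
  have dist: "c {x, y} \<noteq> c {y, z}" "c {y, z} \<noteq> c {z, x}" "c {z, x} \<noteq> c {x, y}"
    "c {x, x'} \<noteq> c {x, y}" "c {x, x'} \<noteq> c {z, x}" "c {y, y'} \<noteq> c {x, y}" "c {y, y'} \<noteq> c {y, z}"
    "c {z, z'} \<noteq> c {y, z}" "c {z, z'} \<noteq> c {z, x}"
    using proper_at d x' y' z' by (auto simp: doubleton_eq_iff)
  have pairs:
    "m y = c {z, x} \<or> m z = c {x, y}" "m y = c {x, x'} \<or> m x' = c {x, y}" "m z = c {x, x'} \<or> m x' = c {z, x}"
    "m x = c {y, z} \<or> m z = c {x, y}" "m x = c {y, y'} \<or> m y' = c {x, y}" "m z = c {y, y'} \<or> m y' = c {y, z}"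
    "m x = c {y, z} \<or> m y = c {z, x}" "m x = c {z, z'} \<or> m z' = c {z, x}" "m y = c {z, z'} \<or> m z' = c {y, z}"
    using pair[OF tri(1) tri'(3)] pair[OF tri(1) x'(1)] pair[OF tri'(3) x'(1)]
      pair[OF tri'(1) tri(2)] pair[OF tri'(1) y'(1)] pair[OF tri(2) y'(1)]
      pair[OF tri(3) tri'(2)] pair[OF tri(3) z'(1)] pair[OF tri'(2) z'(1)] d x' y' z'
    unfolding sym by auto
  have "m x \<noteq> c {x, y}" "m x \<noteq> c {z, x}" "m x \<noteq> c {x, x'}"
    "m y \<noteq> c {x, y}" "m y \<noteq> c {y, z}" "m y \<noteq> c {y, y'}"
    "m z \<noteq> c {z, x}" "m z \<noteq> c {y, z}" "m z \<noteq> c {z, z'}"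
    using in_P[OF tri(1)] in_P[OF tri'(1)] in_P[OF tri(2)] in_P[OF tri'(2)] in_P[OF tri(3)]
      in_P[OF tri'(3)] in_P[OF x'(1)] in_P[OF y'(1)] in_P[OF z'(1)] sym by auto
  with dist pairs show False by metis
qed

section \<open>Chords of a cycle that bounds the exterior face\<close>

lemma plane_embeddingD:
  assumes "plane_embedding V E p \<gamma>"
  shows "inj_on p V"
    and "e \<in> E \<Longrightarrow> arc (\<gamma> e)"
    and "e \<in> E \<Longrightarrow> {pathstart (\<gamma> e), pathfinish (\<gamma> e)} = p ` e"
    and "e \<in> E \<Longrightarrow> v \<in> V \<Longrightarrow> p v \<in> path_image (\<gamma> e) \<Longrightarrow> v \<in> e"
    and "e \<in> E \<Longrightarrow> f \<in> E \<Longrightarrow> e \<noteq> f \<Longrightarrow> path_image (\<gamma> e) \<inter> path_image (\<gamma> f) \<subseteq> p ` (e \<inter> f)"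
  using assms by (simp_all add: plane_embedding_def)

lemma plane_embedding_edge_arc:
  assumes "plane_embedding V E p \<gamma>" "{x, y} \<in> E"
  obtains g where "arc g" "pathstart g = p x" "pathfinish g = p y" "path_image g = path_image (\<gamma> {x, y})"
proof -
  have a: "arc (\<gamma> {x, y})" "{pathstart (\<gamma> {x, y}), pathfinish (\<gamma> {x, y})} = {p x, p y}"
    using plane_embeddingD(2,3)[OF assms] by simp_all
  then consider "pathstart (\<gamma> {x, y}) = p x" "pathfinish (\<gamma> {x, y}) = p y"
    | "pathstart (\<gamma> {x, y}) = p y" "pathfinish (\<gamma> {x, y}) = p x"
    by (auto simp: doubleton_eq_iff)
  then show thesis
  proof cases
    case 1 then show ?thesis using that a by blast
  next
    case 2 then show ?thesis using that[of "reversepath (\<gamma> {x, y})"] a by (simp add: arc_reversepath)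
  qed
qed

lemma edges_image_Int:
  assumes "plane_embedding V E p \<gamma>" "F \<subseteq> E" "F' \<subseteq> E" "F \<inter> F' = {}"
    and AB: "\<Union>F \<subseteq> A" "\<Union>F' \<subseteq> B"
  shows "edges_image \<gamma> F \<inter> edges_image \<gamma> F' \<subseteq> p ` (A \<inter> B)"
proof
  fix z assume "z \<in> edges_image \<gamma> F \<inter> edges_image \<gamma> F'"
  then obtain e f where ef: "e \<in> F" "f \<in> F'" "z \<in> path_image (\<gamma> e) \<inter> path_image (\<gamma> f)"
    by (auto simp: edges_image_def)
  then have "e \<noteq> f" using assms by auto
  then have "path_image (\<gamma> e) \<inter> path_image (\<gamma> f) \<subseteq> p ` (e \<inter> f)"
    using plane_embeddingD(5)[OF assms(1)] assms ef by (meson subsetD)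
  moreover have "e \<inter> f \<subseteq> A \<inter> B" using ef AB by blast
  ultimately show "z \<in> p ` (A \<inter> B)" using ef by (meson image_mono subsetD)
qed

lemma vertex_in_edges_image:
  assumes "plane_embedding V E p \<gamma>" "F \<subseteq> E" "v \<in> V" "p v \<in> edges_image \<gamma> F"
  shows "v \<in> \<Union>F"
  using plane_embeddingD(4)[OF assms(1)] assms by (auto simp: edges_image_def)

lemma edges_image_contains_vertex:
  assumes "plane_embedding V E p \<gamma>" "F \<subseteq> E" "v \<in> \<Union>F"
  shows "p v \<in> edges_image \<gamma> F"
proof -
  obtain e where e: "e \<in> F" "v \<in> e" using assms by blast
  then have "p v \<in> {pathstart (\<gamma> e), pathfinish (\<gamma> e)}"
    using plane_embeddingD(3)[OF assms(1), of e] assms by auto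
  then have "p v \<in> path_image (\<gamma> e)" by auto
  then show ?thesis using e by (auto simp: edges_image_def)
qed

lemma graph_path_arc:
  assumes emb: "plane_embedding V E p \<gamma>" and "graph_path V E xs" "length xs \<ge> 2"
  shows "\<exists>g. arc g \<and> pathstart g = p (hd xs) \<and> pathfinish g = p (last xs)
    \<and> path_image g = edges_image \<gamma> (path_edges xs)"
  using assms(2,3)
proof (induction xs rule: induct_list012)
  case (3 x y zs)
  have e: "{x, y} \<in> E" and path: "graph_path V E (y # zs)" and x: "x \<notin> set (y # zs)"
    using 3(3) by (auto simp: graph_path_def)
  obtain g where g: "arc g" "pathstart g = p x" "pathfinish g = p y" "path_image g = path_image (\<gamma> {x, y})"
    using plane_embedding_edge_arc[OF emb e] .
  show ?case
  proof (cases zs)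
    case Nil
    then show ?thesis using g by (auto simp: edges_image_def)
  next
    case (Cons z zs')
    then obtain h where h: "arc h" "pathstart h = p y" "pathfinish h = p (last (y # zs))"
      "path_image h = edges_image \<gamma> (path_edges (y # zs))"
      using 3(2)[OF path] by auto
    have "{x, y} \<notin> path_edges (y # zs)" using path_edge_subset x by blast
    then have "edges_image \<gamma> {{x, y}} \<inter> edges_image \<gamma> (path_edges (y # zs))
      \<subseteq> p ` ({x, y} \<inter> set (y # zs))"
      using e path path_edge_subset[of _ "y # zs"]
      by (intro edges_image_Int[OF emb]) (auto simp: graph_path_def)
    also have "\<dots> \<subseteq> {p y}" using x by auto
    finally have "path_image g \<inter> path_image h \<subseteq> {pathstart h}"
      using g h by (simp add: edges_image_def)
    then show ?thesis
      using g h Cons arc_join[OF g(1) h(1)]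
      by (intro exI[of _ "g +++ h"]) (auto simp: path_image_join edges_image_def)
  qed
qed auto

text \<open>
  The region outside the curve is connected and does not meet the curve, which is the frontier of
  \<open>outside D\<close>. As it contains \<open>outside D\<close>, it coincides with it and contains no point of \<open>D\<close>.
\<close>

lemma drawing_subset_closed_disc:
  fixes D :: "complex set"
  assumes "compact D" "simple_path g" "pathfinish g = pathstart g" "path_image g \<subseteq> D"
    and front: "frontier (outside D) = path_image g"
  shows "D \<subseteq> path_image g \<union> inside (path_image g)"
proof -
  let ?J = "path_image g"
  have sub: "outside D \<subseteq> outside ?J" by (rule outside_mono) fact
  have "bounded D" using assms by (simp add: compact_imp_bounded)
  then have ne: "outside D \<noteq> {}" by (metis bounded_empty unbounded_outside)
  have conn: "connected (outside ?J)"
    using assms by (intro connected_outside) (auto simp: bounded_simple_path_image)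
  have "outside ?J \<inter> frontier (outside D) = {}" unfolding front using outside_no_overlap by blast
  then have "outside ?J \<subseteq> outside D"
    using connected_Int_frontier[OF conn, of "outside D"] ne sub by blast
  then have "D \<inter> outside ?J = {}" by (metis Int_commute disjoint_iff outside_no_overlap subsetD)
  then show ?thesis using union_with_inside[of ?J] by blast
qed

text \<open>
  The chord \<open>P\<close> runs inside the cycle and divides the interior into the two regions next to the arcs
  \<open>x us y\<close> and \<open>y ws x\<close> of the cycle (the theorem on theta curves). The chord \<open>Q\<close> avoids \<open>P\<close>, so it
  stays in one region; but its end \<open>b\<close> is not on the boundary of the second region, nor its end \<open>d\<close> on
  the boundary of the first.
\<close>

lemma no_crossing_chords:
  assumes emb: "plane_embedding V E p \<gamma>" and fin: "finite V" "finite E"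
    and cyc: "graph_cycle V E (x # us @ y # ws)" and C: "C = cycle_edges (x # us @ y # ws)"
    and front: "frontier (exterior_face V E p \<gamma>) = edges_image \<gamma> C"
    and P: "graph_path V E P" "hd P = x" "last P = y" "path_edges P \<inter> C = {}"
      "set P \<inter> set (x # us @ y # ws) = {x, y}"
    and Q: "graph_path V E Q" "hd Q = b" "last Q = d" "path_edges Q \<inter> C = {}"
      "set Q \<inter> set (x # us @ y # ws) = {b, d}"
    and PQ: "set P \<inter> set Q = {}" and b: "b \<in> set us" and d: "d \<in> set ws"
  shows False
proof -
  let ?xs = "x # us @ y # ws" and ?c1 = "x # us @ [y]" and ?c2 = "y # ws @ [x]"
  have dist: "distinct ?xs" "set ?xs \<subseteq> V" and CE: "C \<subseteq> E" using cyc C by (auto simp: graph_cycle_def)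
  have V: "x \<in> V" "y \<in> V" "b \<in> V" "d \<in> V" and ne: "x \<noteq> y" "b \<noteq> d" "b \<notin> {x, y}" "d \<notin> {x, y}"
    using dist b d by auto
  have len2: "length zs \<ge> 2" if "graph_path V E zs" "hd zs \<noteq> last zs" for zs
    using that by (cases zs rule: remdups_adj.cases) (auto simp: graph_path_def)
  have inj: "inj_on p V" using emb by (rule plane_embeddingD)
  have Csplit: "C = path_edges ?c1 \<union> path_edges ?c2" using C cycle_edges_split by simp
  have c1: "graph_path V E ?c1" and c2: "graph_path V E ?c2"
    using dist CE Csplit by (auto simp: graph_path_def)
  \<comment> \<open>The arcs share only the vertices \<open>x\<close> and \<open>y\<close>, and every edge of the first arc has an end in \<open>us\<close>,
    because \<open>us\<close> contains \<open>b\<close>.\<close>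
  have c12: "path_edges ?c1 \<inter> path_edges ?c2 = {}"
  proof -
    have "us \<noteq> []" using b by auto
    have "e \<notin> path_edges ?c2" if "e \<in> path_edges ?c1" for e
      using path_edge_meets_interior[OF \<open>us \<noteq> []\<close> that] path_edge_subset[of e ?c2] dist by auto
    then show ?thesis by blast
  qed
  have PE: "path_edges P \<subseteq> E" and QE: "path_edges Q \<subseteq> E" using P Q by (auto simp: graph_path_def)
  have sub1: "path_edges ?c1 \<subseteq> E" and sub2: "path_edges ?c2 \<subseteq> E" using Csplit CE by auto
  obtain g1 where g1: "arc g1" "pathstart g1 = p x" "pathfinish g1 = p y"
    "path_image g1 = edges_image \<gamma> (path_edges ?c1)"
    using graph_path_arc[OF emb c1] by auto
  obtain g2' where g2': "arc g2'" "pathstart g2' = p y" "pathfinish g2' = p x"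
    "path_image g2' = edges_image \<gamma> (path_edges ?c2)"
    using graph_path_arc[OF emb c2] by auto
  define g2 where "g2 = reversepath g2'"
  have g2: "arc g2" "pathstart g2 = p x" "pathfinish g2 = p y"
    "path_image g2 = edges_image \<gamma> (path_edges ?c2)"
    using g2' by (auto simp: g2_def arc_reversepath)
  obtain gP where gP: "arc gP" "pathstart gP = p x" "pathfinish gP = p y"
    "path_image gP = edges_image \<gamma> (path_edges P)"
    using graph_path_arc[OF emb P(1) len2] P(1-3) ne by auto
  obtain gQ where gQ: "arc gQ" "pathstart gQ = p b" "pathfinish gQ = p d"
    "path_image gQ = edges_image \<gamma> (path_edges Q)"
    using graph_path_arc[OF emb Q(1) len2] Q(1-3) ne by auto
  define J where "J = path_image g1 \<union> path_image g2"
  have J: "J = edges_image \<gamma> C" by (auto simp: J_def g1 g2 Csplit edges_image_def)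
  have Un: "\<Union>(path_edges zs) \<subseteq> set zs" for zs :: "'a list" using path_edge_subset by blast
  have UnC: "\<Union>C \<subseteq> set ?xs" using Un[of ?c1] Un[of ?c2] by (auto simp: Csplit)
  have ends: "p x \<in> path_image g" "p y \<in> path_image g"
    if "pathstart g = p x" "pathfinish g = p y" for g :: "real \<Rightarrow> complex"
    using that by (metis pathstart_in_path_image pathfinish_in_path_image)+
  have i12: "path_image g1 \<inter> path_image g2 = {p x, p y}"
  proof -
    have "path_image g1 \<inter> path_image g2 \<subseteq> p ` (set ?c1 \<inter> set ?c2)"
      unfolding g1 g2 by (rule edges_image_Int[OF emb sub1 sub2 c12 Un Un])
    also have "\<dots> \<subseteq> {p x, p y}" using dist by auto
    finally show ?thesis using ends[OF g1(2,3)] ends[OF g2(2,3)] by auto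
  qed
  have PJ: "path_image gP \<inter> J \<subseteq> {p x, p y}"
  proof -
    have "path_image gP \<inter> J \<subseteq> p ` (set P \<inter> set ?xs)"
      unfolding gP J by (rule edges_image_Int[OF emb PE CE P(4) Un UnC])
    then show ?thesis using P(5) by auto
  qed
  have QJ: "path_image gQ \<inter> J \<subseteq> {p b, p d}"
  proof -
    have "path_image gQ \<inter> J \<subseteq> p ` (set Q \<inter> set ?xs)"
      unfolding gQ J by (rule edges_image_Int[OF emb QE CE Q(4) Un UnC])
    then show ?thesis using Q(5) by auto
  qed
  have PQ_image: "path_image gP \<inter> path_image gQ = {}"
  proof -
    have e: "e \<noteq> {}" if "e \<in> path_edges P" for e
      using that by (auto simp: path_edges_def)
    have "path_edges P \<inter> path_edges Q = {}"
      using e PQ path_edge_subset[of _ P] path_edge_subset[of _ Q] by fastforce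
    from edges_image_Int[OF emb PE QE this Un Un] show ?thesis
      using PQ unfolding gP gQ by simp
  qed
  have arc_simple: "simple_path g1" "simple_path g2" "simple_path gP"
    using g1 g2 gP by (auto intro: arc_imp_simple_path)
  have "simple_path (g1 +++ g2')"
    using simple_path_join_loop[OF g1(1) g2'(1)] i12 g1 g2 g2' by simp
  moreover have "path_image (g1 +++ g2') = J" using g1 g2 g2' by (simp add: J_def path_image_join)
  ultimately have loop: "simple_path (g1 +++ g2')" "path_image (g1 +++ g2') = J" .
  define D where "D = p ` V \<union> edges_image \<gamma> E"
  have arcs: "arc (\<gamma> e)" if "e \<in> E" for e using plane_embeddingD(2)[OF emb that] .
  have "compact (path_image (\<gamma> e))" if "e \<in> E" for e
    using arcs[OF that] by (simp add: arc_imp_path compact_path_image)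
  then have "compact D"
    using fin by (auto simp: D_def edges_image_def intro!: compact_Un compact_UN finite_imp_compact[of "p ` V"])
  moreover have "J \<subseteq> D" using CE by (auto simp: J D_def edges_image_def)
  moreover have "frontier (outside D) = J" using front by (simp add: D_def exterior_face_def J)
  ultimately have DJ: "D \<subseteq> J \<union> inside J"
    using drawing_subset_closed_disc[of D "g1 +++ g2'"] loop g1 g2' by auto
  have "path_image gP \<subseteq> D" "path_image gQ \<subseteq> D"
    using PE QE by (auto simp: gP gQ D_def edges_image_def)
  then have insP: "path_image gP - {p x, p y} \<subseteq> inside J" and insQ: "path_image gQ - {p b, p d} \<subseteq> inside J"
    using DJ PJ QJ by blast+
  have "path_image gP \<inter> inside J \<noteq> {}"
    using insP nonempty_simple_path_endless[OF arc_simple(3)] gP by auto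
  then have meets: "path_image gP \<inter> inside (path_image g1 \<union> path_image g2) \<noteq> {}"
    by (simp add: J_def)
  have "p x \<noteq> p y" using inj V ne by (auto dest: inj_onD)
  moreover have "path_image g1 \<inter> path_image gP = {p x, p y}" "path_image g2 \<inter> path_image gP = {p x, p y}"
    using PJ ends[OF g1(2,3)] ends[OF g2(2,3)] ends[OF gP(2,3)] by (auto simp: J_def)
  ultimately have split: "inside (path_image g1 \<union> path_image gP) \<inter> inside (path_image g2 \<union> path_image gP) = {}"
     "inside (path_image g1 \<union> path_image gP) \<union> inside (path_image g2 \<union> path_image gP) \<union>
       (path_image gP - {p x, p y}) = inside J"
    using split_inside_simple_closed_curve[OF arc_simple(1) g1(2,3) arc_simple(2) g2(2,3)
        arc_simple(3) gP(2,3) _ i12 _ _ meets]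
    unfolding J_def by metis+
  define I1 where "I1 = inside (path_image g1 \<union> path_image gP)"
  define I2 where "I2 = inside (path_image g2 \<union> path_image gP)"
  have closed: "closed (path_image g1 \<union> path_image gP)" "closed (path_image g2 \<union> path_image gP)"
    using g1(1) g2(1) gP(1) by (auto intro!: closed_Un closed_path_image arc_imp_path)
  define Q0 where "Q0 = path_image gQ - {p b, p d}"
  have simpleQ: "simple_path gQ" using gQ by (simp add: arc_imp_simple_path)
  have Q0: "connected Q0" "Q0 \<noteq> {}"
    using connected_simple_path_endless[OF simpleQ] nonempty_simple_path_endless[OF simpleQ] gQ
    by (auto simp: Q0_def)
  \<comment> \<open>The open arc determines the side, the end points are recovered as limits.\<close>
  have clos: "p b \<in> closure Q0" "p d \<in> closure Q0"
  proof -
    have eq: "Q0 = gQ ` {0<..<1}"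
      using simple_path_endless[OF simpleQ] gQ by (simp add: Q0_def)
    have "gQ ` closure {0<..<1} \<subseteq> closure (gQ ` {0<..<1})"
      using gQ(1) by (intro image_closure_subset[of "{0<..<1::real}" gQ])
        (auto simp: arc_def path_def intro: closure_subset[THEN subsetD])
    then have "path_image gQ \<subseteq> closure Q0" by (simp add: eq path_image_def)
    then show "p b \<in> closure Q0" "p d \<in> closure Q0"
      using gQ(2,3) by (metis pathstart_in_path_image pathfinish_in_path_image subsetD)+
  qed
  have "Q0 \<subseteq> I1 \<union> I2"
    using insQ split(2) PQ_image unfolding I1_def I2_def Q0_def by blast
  moreover have "open I1" "open I2" using closed by (auto simp: I1_def I2_def open_inside)
  ultimately have "Q0 \<subseteq> I1 \<or> Q0 \<subseteq> I2"
    using Q0 split(1) connectedD[OF Q0(1), of I1 I2] unfolding I1_def I2_def by blast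
  moreover have "\<not> Q0 \<subseteq> I1"
  proof
    assume "Q0 \<subseteq> I1"
    then have "p d \<in> closure I1" using clos closure_mono by blast
    then have "p d \<in> I1 \<union> (path_image g1 \<union> path_image gP)"
      using closure_inside_subset[OF closed(1)] by (auto simp: I1_def)
    moreover have "p d \<notin> path_image g1"
      using vertex_in_edges_image[OF emb sub1 V(4)] Un[of ?c1] dist d unfolding g1 by auto
    moreover have "p d \<notin> path_image gP"
      using vertex_in_edges_image[OF emb PE V(4)] Un[of P] PQ Q(5) unfolding gP by auto
    moreover have "p d \<in> J"
      using edges_image_contains_vertex[OF emb CE, of d] Union_path_edges[of ?c2] d
      unfolding J Csplit by auto
    moreover have "I1 \<inter> J = {}" using split(2) inside_no_overlap[of J] unfolding I1_def by blast
    ultimately show False by blast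
  qed
  moreover have "\<not> Q0 \<subseteq> I2"
  proof
    assume "Q0 \<subseteq> I2"
    then have "p b \<in> closure I2" using clos closure_mono by blast
    then have "p b \<in> I2 \<union> (path_image g2 \<union> path_image gP)"
      using closure_inside_subset[OF closed(2)] by (auto simp: I2_def)
    moreover have "p b \<notin> path_image g2"
      using vertex_in_edges_image[OF emb sub2 V(3)] Un[of ?c2] dist b unfolding g2 by auto
    moreover have "p b \<notin> path_image gP"
      using vertex_in_edges_image[OF emb PE V(3)] Un[of P] PQ Q(5) unfolding gP by auto
    moreover have "p b \<in> J"
      using edges_image_contains_vertex[OF emb CE, of b] Union_path_edges[of ?c1] b
      unfolding J Csplit by auto
    moreover have "I2 \<inter> J = {}" using split(2) inside_no_overlap[of J] unfolding I2_def by blast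
    ultimately show False by blast
  qed
  ultimately show False by blast
qed

section \<open>Rooted trees\<close>

lemma graph_path_take:
  assumes "graph_path V E xs" "n > 0"
  shows "graph_path V E (take n xs)"
proof -
  have "path_edges (take n xs) \<subseteq> path_edges xs" unfolding path_edges_def by auto
  then show ?thesis using assms set_take_subset[of n xs] by (auto simp: graph_path_def)
qed

lemma graph_path_snoc:
  "graph_path V E xs \<Longrightarrow> {last xs, y} \<in> E \<Longrightarrow> y \<in> V \<Longrightarrow> y \<notin> set xs \<Longrightarrow> graph_path V E (xs @ [y])"
  by (auto simp: graph_path_def path_edges_append)

text \<open>
  The reflexive transitive closure of \<open>link S E\<close> is connectedness inside \<open>S\<close>. Unlike lists of distinct
  vertices, it can be composed and reversed freely.
\<close>

definition link :: "'a set \<Rightarrow> 'a set set \<Rightarrow> ('a \<times> 'a) set" where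
  "link S E = {(u, v). u \<in> S \<and> v \<in> S \<and> {u, v} \<in> E}"

lemma link_connected_sym: "(x, y) \<in> (link S E)\<^sup>* \<Longrightarrow> (y, x) \<in> (link S E)\<^sup>*"
  by (rule symD[OF sym_rtrancl]) (auto simp: sym_def link_def insert_commute)

lemma graph_path_to_member:
  assumes "graph_path V E xs" "y \<in> set xs"
  obtains ys where "graph_path V E ys" "hd ys = hd xs" "last ys = y" "set ys \<subseteq> set xs"
    "length ys \<le> length xs" "length ys = length xs \<Longrightarrow> y = last xs"
proof -
  obtain i where i: "i < length xs" "y = xs ! i" using assms by (metis in_set_conv_nth)
  let ?ys = "take (Suc i) xs"
  have "last ?ys = y" using i by (simp add: take_Suc_conv_app_nth)
  moreover have "hd ?ys = hd xs" using i by (cases xs) auto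
  moreover have "y = last xs" if "length ?ys = length xs"
  proof -
    have "length xs = Suc i" using that i by simp
    then show ?thesis using i last_conv_nth[of xs] by (cases xs) auto
  qed
  ultimately show thesis
    using that[of ?ys] graph_path_take[OF assms(1), of "Suc i"] set_take_subset[of "Suc i" xs] by simp
qed

lemma graph_path_of_link:
  assumes "(x, y) \<in> (link S E)\<^sup>*" "x \<in> S" "S \<subseteq> V"
  shows "\<exists>p. graph_path V E p \<and> hd p = x \<and> last p = y \<and> set p \<subseteq> S"
  using assms(1)
proof (induction rule: rtrancl_induct)
  case base
  show ?case using assms by (intro exI[of _ "[x]"]) (auto simp: graph_path_def)
next
  case (step y z)
  then obtain p where p: "graph_path V E p" "hd p = x" "last p = y" "set p \<subseteq> S" by blast
  show ?case
  proof (cases "z \<in> set p")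
    case True
    then show ?thesis using graph_path_to_member[OF p(1) True] p by (metis subset_trans)
  next
    case False
    then have "graph_path V E (p @ [z])"
      using step p assms by (intro graph_path_snoc) (auto simp: link_def)
    then show ?thesis using p step by (intro exI[of _ "p @ [z]"]) (auto simp: graph_path_def link_def)
  qed
qed

lemma link_of_graph_path:
  assumes "graph_path V E p" "set p \<subseteq> S" "y \<in> set p"
  shows "(hd p, y) \<in> (link S E)\<^sup>*"
  using assms
proof (induction p rule: induct_list012)
  case (3 x z zs)
  show ?case
  proof (cases "y = x")
    case False
    have "(z, y) \<in> (link S E)\<^sup>*" using 3 False by (auto simp: graph_path_def)
    moreover have "(x, z) \<in> link S E" using 3 by (auto simp: link_def graph_path_def)
    ultimately show ?thesis by (simp add: converse_rtrancl_into_rtrancl)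
  qed auto
qed (auto simp: graph_path_def)

locale rooted_tree =
  fixes V :: "'a set" and T :: "'a set set" and r :: 'a
  assumes tree: "tree V T" and root: "r \<in> V"
begin

definition depth :: "'a \<Rightarrow> nat" where
  "depth v = graph_dist V T r v"

lemma simple: "simple_graph V T"
  using tree by (simp add: tree_def)

lemmas edgeD = simple_graph_edgeD[OF simple]

lemma shortest_path:
  assumes "v \<in> V"
  obtains p where "graph_path V T p" "hd p = r" "last p = v" "length p = Suc (depth v)"
proof -
  obtain xs where "graph_path V T xs" "hd xs = r" "last xs = v"
    using tree root assms unfolding tree_def graph_connected_def by blast
  then have "\<exists>n xs. graph_path V T xs \<and> hd xs = r \<and> last xs = v \<and> length xs = Suc n"
    by (intro exI[of _ "length xs - 1"] exI[of _ xs]) (auto simp: graph_path_def)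
  from LeastI_ex[OF this] show thesis using that unfolding depth_def graph_dist_def by blast
qed

lemma depth_le: "graph_path V T p \<Longrightarrow> hd p = r \<Longrightarrow> depth (last p) < length p"
proof -
  assume p: "graph_path V T p" "hd p = r"
  then have "length p = Suc (length p - 1)" by (cases p) (auto simp: graph_path_def)
  then have "depth (last p) \<le> length p - 1"
    unfolding depth_def graph_dist_def using p by (intro Least_le) blast
  then show ?thesis using \<open>length p = _\<close> by linarith
qed

lemma depth_root [simp]: "depth r = 0"
  using depth_le[of "[r]"] root by (simp add: graph_path_def)

lemma depth_less_card: "v \<in> V \<Longrightarrow> depth v < card V"
proof -
  assume "v \<in> V"
  then obtain p where p: "graph_path V T p" "length p = Suc (depth v)" by (rule shortest_path)
  moreover have "finite V" using simple by (simp add: simple_graph_def)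
  ultimately have "card (set p) \<le> card V" by (intro card_mono) (auto simp: graph_path_def)
  then show ?thesis using p by (simp add: graph_path_def distinct_card)
qed

lemma depth_edge: "{u, v} \<in> T \<Longrightarrow> depth v \<le> Suc (depth u)"
proof -
  assume e: "{u, v} \<in> T"
  obtain p where p: "graph_path V T p" "hd p = r" "last p = u" "length p = Suc (depth u)"
    using shortest_path edgeD[OF e] by blast
  show ?thesis
  proof (cases "v \<in> set p")
    case True
    then obtain q where "graph_path V T q" "hd q = r" "last q = v" "length q \<le> length p"
      using graph_path_to_member[OF p(1) True] p by metis
    then show ?thesis using depth_le[of q] p by auto
  next
    case False
    have "graph_path V T (p @ [v])" using p e edgeD[OF e] False by (intro graph_path_snoc) auto
    moreover have "hd (p @ [v]) = r" using p by (cases p) auto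
    ultimately show ?thesis using depth_le[of "p @ [v]"] p by auto
  qed
qed

lemma depth_predecessor:
  assumes "v \<in> V" "v \<noteq> r"
  shows "\<exists>u. {u, v} \<in> T \<and> Suc (depth u) = depth v"
proof -
  obtain p where p: "graph_path V T p" "hd p = r" "last p = v" "length p = Suc (depth v)"
    using shortest_path[OF assms(1)] .
  then obtain q where q: "p = q @ [v]" by (metis append_butlast_last_id graph_path_def)
  have ne: "q \<noteq> []" using q p assms by auto
  have "hd q = r" "{last q, v} \<in> T" using p q ne by (auto simp: graph_path_def path_edges_append)
  moreover have "graph_path V T q" using graph_path_take[OF p(1), of "length q"] q ne by auto
  ultimately have "depth (last q) < length q" "{last q, v} \<in> T" using depth_le by auto
  moreover have "length q = depth v" using p q by auto
  ultimately show ?thesis using depth_edge[of "last q" v] by (intro exI[of _ "last q"]) auto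
qed

text \<open>
  A path from \<open>x\<close> to \<open>y\<close> that avoids \<open>u\<close> is closed to a cycle by \<open>u\<close>.
\<close>

lemma no_cycle_through:
  assumes "(x, y) \<in> (link (V - {u}) T)\<^sup>*" "x \<noteq> y" "{u, x} \<in> T" "{u, y} \<in> T"
  shows False
proof -
  have "x \<in> V - {u}" using edgeD[OF assms(3)] by auto
  then obtain p where p: "graph_path V T p" "hd p = x" "last p = y" "set p \<subseteq> V - {u}"
    using graph_path_of_link[OF assms(1)] by blast
  then obtain z zs where zs: "p = x # z # zs" using assms(2)
    by (cases p rule: remdups_adj.cases) (auto simp: graph_path_def)
  have "graph_cycle V T (u # p)"
    using p assms edgeD[OF assms(3)] by (auto simp: zs graph_path_def graph_cycle_def cycle_edges_def insert_commute)
  then show False using tree by (auto simp: tree_def)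
qed

text \<open>
  A shortest path from the root to \<open>u\<close> visits, before \<open>u\<close>, only vertices of smaller depth.
\<close>

lemma root_avoiding:
  assumes "{u, v} \<in> T" "depth u \<le> depth v"
  shows "(r, u) \<in> (link (V - {v}) T)\<^sup>*"
proof -
  obtain p where p: "graph_path V T p" "hd p = r" "last p = u" "length p = Suc (depth u)"
    using shortest_path edgeD[OF assms(1)] by blast
  have "v \<notin> set p"
  proof
    assume "v \<in> set p"
    then obtain q where q: "graph_path V T q" "hd q = r" "last q = v" "length q \<le> length p"
      "length q = length p \<Longrightarrow> v = u"
      using graph_path_to_member[OF p(1)] p by metis
    then show False using depth_le[of q] edgeD[OF assms(1)] assms(2) p by auto
  qed
  then have "set p \<subseteq> V - {v}" "u \<in> set p" using p by (auto simp: graph_path_def)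
  then show ?thesis using link_of_graph_path[OF p(1)] p by auto
qed

text \<open>
  Both \<open>u\<close> and \<open>w\<close> are connected to the root without \<open>v\<close>, hence to each other.
\<close>

lemma upward_edge_unique:
  assumes "{u, v} \<in> T" "{w, v} \<in> T" "depth u \<le> depth v" "depth w \<le> depth v"
  shows "u = w"
proof (rule ccontr)
  assume "u \<noteq> w"
  have "(u, w) \<in> (link (V - {v}) T)\<^sup>*"
    using root_avoiding[OF assms(1,3)] root_avoiding[OF assms(2,4)] link_connected_sym rtrancl_trans by metis
  then show False using no_cycle_through[of u w v] \<open>u \<noteq> w\<close> assms by (auto simp: insert_commute)
qed

definition par :: "'a \<Rightarrow> 'a" where
  "par v = (if v = r then r else SOME u. {u, v} \<in> T \<and> Suc (depth u) = depth v)"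

lemma par_root [simp]: "par r = r"
  by (simp add: par_def)

lemma funpow_par_root [simp]: "(par ^^ k) r = r"
  by (induction k) auto

lemma par:
  assumes "v \<in> V" "v \<noteq> r"
  shows "{par v, v} \<in> T" "Suc (depth (par v)) = depth v"
  using someI_ex[OF depth_predecessor[OF assms]] assms by (auto simp: par_def)

lemma par_in_V: "v \<in> V \<Longrightarrow> par v \<in> V"
  using par[of v] edgeD root by (cases "v = r") auto

lemma funpow_par_in_V: "v \<in> V \<Longrightarrow> (par ^^ k) v \<in> V"
  by (induction k) (auto simp: par_in_V)

lemma depth_par: "v \<in> V \<Longrightarrow> depth (par v) = depth v - 1"
  using par[of v] by (cases "v = r") auto

lemma depth_funpow_par: "v \<in> V \<Longrightarrow> depth ((par ^^ k) v) = depth v - k"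
  by (induction k) (auto simp: depth_par funpow_par_in_V)

lemma depth_eq_0: "v \<in> V \<Longrightarrow> depth v = 0 \<Longrightarrow> v = r"
  using par(2)[of v] by fastforce

lemma edge_par:
  assumes "{u, v} \<in> T"
  shows "u \<noteq> r \<and> par u = v \<or> v \<noteq> r \<and> par v = u"
proof -
  have *: "par b = a \<and> b \<noteq> r" if e: "{a, b} \<in> T" and d: "depth a \<le> depth b" for a b
  proof -
    have b: "b \<noteq> r" using d depth_eq_0 edgeD[OF e] by auto
    then show ?thesis
      using upward_edge_unique[OF e par(1)] d par(2) edgeD[OF e] by fastforce
  qed
  have "{v, u} \<in> T" using assms by (simp add: insert_commute)
  then show ?thesis using *[OF assms] * linear[of "depth u" "depth v"] by blast
qed

definition children :: "'a \<Rightarrow> 'a set" where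
  "children v = {w \<in> V - {r}. par w = v}"

lemma children: "w \<in> children v \<Longrightarrow> w \<in> V \<and> w \<noteq> r \<and> par w = v \<and> depth w = Suc (depth v)"
  using par(2)[of w] by (auto simp: children_def)

lemma degree_children:
  assumes "v \<in> V"
  shows "degree T v = card (children v) + (if v = r then 0 else 1)"
proof -
  let ?N = "children v \<union> (if v = r then {} else {par v})"
  have edges: "{e \<in> T. v \<in> e} = (\<lambda>w. {v, w}) ` ?N"
  proof (intro equalityI subsetI)
    fix e assume e: "e \<in> {e \<in> T. v \<in> e}"
    then obtain w where w: "e = {v, w}"
      using simple unfolding simple_graph_def by (metis (no_types, lifting) card_2_iff insertE insert_commute mem_Collect_eq singletonD)
    then have "{w, v} \<in> T" using e by (simp add: insert_commute)
    then have "w \<in> ?N" using edge_par[of w v] edgeD[of w v] by (auto simp: children_def)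
    then show "e \<in> (\<lambda>w. {v, w}) ` ?N" using w by blast
  next
    fix e assume "e \<in> (\<lambda>w. {v, w}) ` ?N"
    then obtain w where w: "w \<in> ?N" "e = {v, w}" by blast
    then consider "w \<in> children v" | "v \<noteq> r" "w = par v" by (auto split: if_splits)
    then have "{v, w} \<in> T"
    proof cases
      case 1
      then show ?thesis using par(1)[of w] children by metis
    next
      case 2
      then show ?thesis using par(1)[OF assms] by (metis insert_commute)
    qed
    then show "e \<in> {e \<in> T. v \<in> e}" using w by simp
  qed
  have "inj_on (\<lambda>w. {v, w}) ?N" by (auto simp: inj_on_def doubleton_eq_iff)
  then have "degree T v = card ?N" unfolding degree_def edges by (rule card_image)
  also have "\<dots> = card (children v) + (if v = r then 0 else 1)"
  proof -
    have "finite (children v)" using simple by (auto simp: children_def simple_graph_def)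
    moreover have "par v \<notin> children v" if "v \<noteq> r" using children[of "par v" v] par(2)[OF assms that] by auto
    ultimately show ?thesis by (auto simp: card_insert_if)
  qed
  finally show ?thesis .
qed

definition below :: "'a \<Rightarrow> 'a set" where
  "below v = {w \<in> V. \<exists>k. (par ^^ k) w = v}"

lemma below_par: "par w \<in> below v \<Longrightarrow> w \<in> V \<Longrightarrow> w \<in> below v"
proof -
  assume "par w \<in> below v" "w \<in> V"
  then obtain k where "(par ^^ k) (par w) = v" by (auto simp: below_def)
  then have "(par ^^ Suc k) w = v" by (simp add: funpow_swap1)
  then show ?thesis using \<open>w \<in> V\<close> unfolding below_def by blast
qed

lemma below_connected:
  assumes "w \<in> below v"
  shows "(w, v) \<in> (link (below v) T)\<^sup>*"
proof -
  obtain k where "(par ^^ k) w = v" "w \<in> V" using assms by (auto simp: below_def)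
  then show ?thesis
  proof (induction k arbitrary: w)
    case (Suc k)
    show ?case
    proof (cases "w = r")
      case True
      then have "w = v" using Suc.prems funpow_par_root[of "Suc k"] by simp
      then show ?thesis by simp
    next
      case False
      have k: "(par ^^ k) (par w) = v" using Suc by (simp add: funpow_swap1)
      then have "(par w, v) \<in> (link (below v) T)\<^sup>*" using Suc par_in_V by blast
      moreover have "(w, par w) \<in> link (below v) T"
      proof -
        have "par w \<in> below v" using k par_in_V Suc.prems(2) by (auto simp: below_def)
        then show ?thesis
          using par(1)[OF Suc.prems(2) False] below_par Suc.prems(2)
          by (simp add: link_def insert_commute)
      qed
      ultimately show ?thesis by (rule converse_rtrancl_into_rtrancl[rotated])
    qed
  qed simp
qed

lemma above_connected:
  assumes "w \<in> V - below v"
  shows "(w, r) \<in> (link (V - below v) T)\<^sup>*"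
  using assms
proof (induction "depth w" arbitrary: w)
  case 0
  then show ?case using depth_eq_0 by auto
next
  case (Suc n)
  then have w: "w \<noteq> r" "w \<in> V" by auto
  have "par w \<in> V - below v" using Suc below_par par_in_V by blast
  moreover have "depth (par w) = n" using Suc depth_par w by simp
  ultimately have "(par w, r) \<in> (link (V - below v) T)\<^sup>*" using Suc by blast
  moreover have "(w, par w) \<in> link (V - below v) T"
    using Suc par(1) w \<open>par w \<in> _\<close> unfolding link_def by (auto simp: insert_commute)
  ultimately show ?case by (rule converse_rtrancl_into_rtrancl[rotated])
qed

end

section \<open>Complete cubic trees\<close>

locale complete_cubic_tree = rooted_tree +
  fixes l :: nat
  assumes l: "l \<ge> 1"
    and depth_leaf: "v \<in> leaves V T \<Longrightarrow> depth v = l"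
    and degree_inner: "v \<in> V - leaves V T \<Longrightarrow> degree T v = 3"
begin

lemma finite_V: "finite V"
  using simple by (simp add: simple_graph_def)

lemma finite_T: "finite T"
  using simple finite_V by (auto simp: simple_graph_def intro: finite_subset[of T "Pow V"])

lemma leaves_in_V: "leaves V T \<subseteq> V"
  by (auto simp: leaves_def)

text \<open>
  A vertex that is not a leaf has degree 3 and thus a child; descending stops only at a leaf.
\<close>

lemma leaf_below:
  assumes "v \<in> V"
  shows "\<exists>x\<in>leaves V T. \<exists>k. (par ^^ k) x = v \<and> depth x = depth v + k"
  using assms
proof (induction "card V - depth v" arbitrary: v rule: less_induct)
  case less
  show ?case
  proof (cases "v \<in> leaves V T")
    case True
    then show ?thesis by (intro bexI[of _ v] exI[of _ 0]) auto
  next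
    case False
    then have "degree T v = 3" using degree_inner less.prems by blast
    then have "children v \<noteq> {}" using degree_children[OF less.prems] by (auto split: if_splits)
    then obtain w where "w \<in> children v" by blast
    then have w: "w \<in> V" "par w = v" "depth w = Suc (depth v)" using children by blast+
    then have "card V - depth w < card V - depth v" using depth_less_card[OF w(1)] by simp
    from less.hyps[OF this w(1)] obtain x k where
      "x \<in> leaves V T" "(par ^^ k) x = w" "depth x = depth w + k" by blast
    then show ?thesis using w by (intro bexI[of _ x] exI[of _ "Suc k"]) auto
  qed
qed

lemma leaf_iff_depth:
  assumes "v \<in> V"
  shows "v \<in> leaves V T \<longleftrightarrow> depth v = l"
proof
  assume "depth v = l"
  obtain x k where x: "x \<in> leaves V T" "(par ^^ k) x = v" "depth x = depth v + k"
    using leaf_below[OF assms] by blast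
  then have "k = 0" using depth_leaf[OF x(1)] \<open>depth v = l\<close> by simp
  then show "v \<in> leaves V T" using x by simp
qed (rule depth_leaf)

text \<open>
  The induction step that is common to the count below an inner vertex, which has two children, and
  below the root, which has three.
\<close>

lemma card_leaves_below_Suc:
  assumes "v \<in> V" "depth v + Suc k = l"
    and IH: "\<And>w. w \<in> children v \<Longrightarrow> card {x \<in> leaves V T. (par ^^ k) x = w} = n"
  shows "card {x \<in> leaves V T. (par ^^ Suc k) x = v} = card (children v) * n"
proof -
  have "{x \<in> leaves V T. (par ^^ Suc k) x = v} = (\<Union>w\<in>children v. {x \<in> leaves V T. (par ^^ k) x = w})"
  proof (intro equalityI subsetI)
    fix x assume "x \<in> {x \<in> leaves V T. (par ^^ Suc k) x = v}"
    then have x: "x \<in> leaves V T" "par ((par ^^ k) x) = v" by auto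
    have "x \<in> V" using x leaves_in_V by blast
    then have "(par ^^ k) x \<in> V" "depth ((par ^^ k) x) = l - k"
      using depth_funpow_par[of x k] depth_leaf[OF x(1)] funpow_par_in_V by simp_all
    moreover from this have "(par ^^ k) x \<noteq> r" using assms(2) by (metis depth_root diff_is_0_eq not_less_eq_eq le_add2 add.commute)
    ultimately have "(par ^^ k) x \<in> children v" using x by (simp add: children_def)
    then show "x \<in> (\<Union>w\<in>children v. {x \<in> leaves V T. (par ^^ k) x = w})" using x by blast
  qed (auto simp: children_def)
  moreover have "finite (children v)" using finite_V by (auto simp: children_def)
  moreover have "finite (leaves V T)" using finite_V leaves_in_V finite_subset by blast
  ultimately show ?thesis by (simp add: card_UN_disjoint IH disjoint_iff)
qed

lemma card_leaves_below:
  assumes "v \<in> V" "v \<noteq> r" "depth v + k = l"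
  shows "card {x \<in> leaves V T. (par ^^ k) x = v} = 2 ^ k"
  using assms
proof (induction k arbitrary: v)
  case 0
  then have "v \<in> leaves V T" using leaf_iff_depth by simp
  then have "{x \<in> leaves V T. (par ^^ 0) x = v} = {v}" by auto
  then show ?case by simp
next
  case (Suc k)
  then have "degree T v = 3" using degree_inner leaf_iff_depth by auto
  then have "card (children v) = 2" using degree_children Suc.prems by auto
  moreover have "card {x \<in> leaves V T. (par ^^ k) x = w} = 2 ^ k" if "w \<in> children v" for w
    using Suc children[OF that] by auto
  ultimately show ?case using card_leaves_below_Suc[OF Suc.prems(1,3)] by simp
qed

lemma card_leaves: "card (leaves V T) = 3 * 2 ^ (l - 1)"
proof -
  have "degree T r = 3" using degree_inner leaf_iff_depth[OF root] l root by auto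
  then have "card (children r) = 3" using degree_children[OF root] by auto
  moreover have "card {x \<in> leaves V T. (par ^^ (l - 1)) x = w} = 2 ^ (l - 1)" if "w \<in> children r" for w
    using card_leaves_below children[OF that] l by auto
  ultimately have "card {x \<in> leaves V T. (par ^^ Suc (l - 1)) x = r} = 3 * 2 ^ (l - 1)"
    using card_leaves_below_Suc[OF root, of "l - 1" "2 ^ (l - 1)"] l by simp
  moreover have "{x \<in> leaves V T. (par ^^ Suc (l - 1)) x = r} = leaves V T"
  proof -
    have "(par ^^ l) x = r" if x: "x \<in> leaves V T" for x
    proof -
      have "x \<in> V" using x leaves_in_V by blast
      then show ?thesis
        using depth_funpow_par[of x l] depth_leaf[OF x] depth_eq_0[OF funpow_par_in_V] by simp
    qed
    moreover have "Suc (l - 1) = l" using l by simp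
    ultimately show ?thesis by (simp only:) blast
  qed
  ultimately show ?thesis by simp
qed

lemma leaf_on_path:
  assumes "graph_path V T P" "w \<in> set P" "w \<in> leaves V T"
  shows "w = hd P \<or> w = last P"
proof (rule ccontr)
  assume no: "\<not> ?thesis"
  obtain as bs where P: "P = as @ w # bs" using assms(2) by (metis split_list)
  have ne: "as \<noteq> []" "bs \<noteq> []" using no P by auto
  then obtain as' a b bs' where ab: "as = as' @ [a]" "bs = b # bs'"
    by (cases as rule: rev_cases; cases bs) auto
  have "path_edges P = insert {a, w} (path_edges (as' @ [a]) \<union> path_edges (w # b # bs'))"
    using path_edges_append[of "as' @ [a]" "w # b # bs'"] P ab by simp
  then have e: "{a, w} \<in> T" "{w, b} \<in> T" and "a \<noteq> b"
    using assms(1) P ab by (auto simp: graph_path_def)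
  then have "{{a, w}, {w, b}} \<subseteq> {e \<in> T. w \<in> e}" "{a, w} \<noteq> {w, b}" by (auto simp: doubleton_eq_iff)
  then have "2 \<le> degree T w"
    unfolding degree_def using card_mono[of "{e \<in> T. w \<in> e}" "{{a, w}, {w, b}}"] finite_T by simp
  then show False using assms(3) by (simp add: leaves_def)
qed

end

section \<open>Intervals on a line and on a cycle\<close>

text \<open>
  The fibres of \<open>f\<close> are disjoint intervals of length \<open>s\<close> that cover \<open>{..<N}\<close>, so they follow each other
  without gaps: once the fibres through \<open>0, s, \<dots>, (q - 1) * s\<close> are known to be the first \<open>q\<close> blocks, the
  fibre through \<open>q * s\<close> has nothing below \<open>q * s\<close> and must be the next block.
\<close>

lemma convex_fibres_div:
  fixes f :: "nat \<Rightarrow> 'b"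
  assumes convex: "\<And>i m j. i < m \<Longrightarrow> m < j \<Longrightarrow> j < N \<Longrightarrow> f i = f j \<Longrightarrow> f m = f i"
    and size: "\<And>j. j < N \<Longrightarrow> card {i. i < N \<and> f i = f j} = s" and s: "s > 0"
    and ij: "i < N" "j < N"
  shows "f i = f j \<longleftrightarrow> i div s = j div s"
proof -
  have block: "{i. i < N \<and> f i = f (q * s)} = {q * s..<q * s + s}" if "q * s < N" for q
    using that
  proof (induction q rule: less_induct)
    case (less q)
    let ?F = "{i. i < N \<and> f i = f (q * s)}"
    have lower: "q * s \<le> i" if "i \<in> ?F" for i
    proof (rule ccontr)
      assume i: "\<not> q * s \<le> i"
      then have q': "i div s < q" using s by (simp add: div_less_iff_less_mult)
      have le: "i div s * s \<le> i" by simp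
      then have eq: "{i'. i' < N \<and> f i' = f (i div s * s)} = {i div s * s..<i div s * s + s}"
        using less.IH[OF q'] le_less_trans[OF le] less.prems i by simp
      have "i < i div s * s + s" using s dividend_less_div_times[of s i] by simp
      then have "i \<in> {i div s * s..<i div s * s + s}" using le by simp
      then have "f i = f (i div s * s)" unfolding eq[symmetric] by blast
      then have "q * s \<in> {i'. i' < N \<and> f i' = f (i div s * s)}" using that less.prems by simp
      then have "q * s < i div s * s + s" unfolding eq by simp
      then have "q * s < Suc (i div s) * s" by simp
      then have "q < Suc (i div s)" using mult_less_cancel2 by blast
      with q' show False by simp
    qed
    have fin: "finite ?F" by simp
    have ne: "?F \<noteq> {}" using less.prems by auto
    define b where "b = Max ?F"
    have b: "b \<in> ?F" unfolding b_def by (rule Max_in[OF fin ne])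
    have b_max: "i \<le> b" if "i \<in> ?F" for i
      unfolding b_def using fin that by (rule Max_ge)
    have F: "?F = {q * s..b}"
    proof (intro equalityI subsetI)
      fix i assume i: "i \<in> {q * s..b}"
      show "i \<in> ?F"
      proof (cases "i = q * s \<or> i = b")
        case False
        then show ?thesis using convex[of "q * s" i b] b i by auto
      qed (use b less.prems in auto)
    next
      fix i assume "i \<in> ?F"
      then show "i \<in> {q * s..b}" using lower b_max by (simp only: atLeastAtMost_iff)
    qed
    have "card {q * s..b} = s" using size[OF less.prems] unfolding F .
    moreover have "q * s \<le> b" using b_max[of "q * s"] less.prems by blast
    ultimately have "Suc b = q * s + s" by simp
    then show ?case unfolding F by auto
  qed
  have f_div: "f i = f (i div s * s)"
    and div_block: "{i'. i' < N \<and> f i' = f (i div s * s)} = {i div s * s..<i div s * s + s}" if "i < N" for i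
  proof -
    have le: "i div s * s \<le> i" by simp
    show eq: "{i'. i' < N \<and> f i' = f (i div s * s)} = {i div s * s..<i div s * s + s}"
      using le_less_trans[OF le that] by (rule block)
    have "i < i div s * s + s" using s dividend_less_div_times[of s i] by simp
    then have "i \<in> {i div s * s..<i div s * s + s}" using le by simp
    then show "f i = f (i div s * s)" unfolding eq[symmetric] by blast
  qed
  show ?thesis
  proof
    assume "i div s = j div s"
    then show "f i = f j" using f_div[OF ij(1)] f_div[OF ij(2)] by simp
  next
    assume eq: "f i = f j"
    then have "j \<in> {i'. i' < N \<and> f i' = f (i div s * s)}" using f_div[OF ij(1)] ij by simp
    then have "i div s * s \<le> j" "j < i div s * s + s" unfolding div_block[OF ij(1)] by auto
    then show "i div s = j div s" by (intro div_nat_eqI[symmetric]) (simp_all add: mult.commute)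
  qed
qed

text \<open>
  A cyclic sequence is cut between an element outside \<open>A\<close> and an element of \<open>A\<close>. Then neither a subset
  of \<open>A\<close> nor a set disjoint from \<open>A\<close> contains both ends of the resulting list.
\<close>

lemma rotation_starting_in:
  assumes "x \<in> set xs" "x \<in> A" "y \<in> set xs" "y \<notin> A"
  shows "\<exists>us vs. xs = us @ vs \<and> hd (vs @ us) \<in> A \<and> last (vs @ us) \<notin> A"
proof (cases "hd xs \<in> A")
  case False
  obtain us a ws where xs: "xs = us @ a # ws" "a \<in> A" "\<forall>z\<in>set us. z \<notin> A"
    using split_list_first_prop[of xs "\<lambda>z. z \<in> A"] assms by blast
  then have "us \<noteq> []" using False by auto
  then show ?thesis using xs by (intro exI[of _ us] exI[of _ "a # ws"]) auto
next
  case True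
  show ?thesis
  proof (cases "last xs \<in> A")
    case False
    then show ?thesis using True by (intro exI[of _ "[]"] exI[of _ xs]) auto
  next
    case last: True
    obtain us b ws where xs: "xs = us @ b # ws" "b \<notin> A" "\<forall>z\<in>set ws. \<not> z \<notin> A"
      using split_list_last_prop[of xs "\<lambda>z. z \<notin> A"] assms by blast
    then have "ws \<noteq> []" using last by auto
    then show ?thesis using xs by (intro exI[of _ "us @ [b]"] exI[of _ ws]) auto
  qed
qed

lemma degree_cycle_edges:
  assumes "distinct xs" "length xs \<ge> 3" "v \<in> set xs"
  shows "card {e \<in> cycle_edges xs. v \<in> e} = 2"
proof -
  obtain us ws where xs: "xs = us @ v # ws" using assms(3) by (metis split_list)
  define zs where "zs = ws @ us"
  have zs: "distinct (v # zs)" "length zs \<ge> 2" using assms xs by (auto simp: zs_def)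
  have "cycle_edges xs = cycle_edges (v # zs)"
    using cycle_edges_append_commute[of us "v # ws"] by (simp add: xs zs_def)
  also obtain a b bs where ab: "zs = a # b # bs" using zs(2) by (cases zs rule: remdups_adj.cases) auto
  then have "{e \<in> cycle_edges (v # zs). v \<in> e} = {{last (b # bs), v}, {v, a}}"
    using zs(1) path_edge_subset[of _ "a # b # bs"] by (fastforce simp: cycle_edges_def)
  finally have eq: "{e \<in> cycle_edges xs. v \<in> e} = {{last (b # bs), v}, {v, a}}" .
  have "last (b # bs) \<in> set (b # bs)" by (rule last_in_set) simp
  then have "last (b # bs) \<noteq> a" "last (b # bs) \<noteq> v" using zs(1) ab by auto
  then show ?thesis unfolding eq by (auto simp: doubleton_eq_iff)
qed

section \<open>Coordinates on a complete cubic Halin graph\<close>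

text \<open>
  The model with \<open>l\<close> levels: \<open>(k, i)\<close> is the node number \<open>i\<close> at height \<open>k\<close> above the leaves, \<open>(l, 0)\<close> is
  the root, and \<open>up l\<close> sends a node to its parent. Each node at height \<open>l - 1\<close> has the root as its
  parent, because the root has three children and not two.
\<close>

definition up :: "nat \<Rightarrow> nat \<times> nat \<Rightarrow> nat \<times> nat" where
  "up l = (\<lambda>(k, i). if Suc k < l then (Suc k, i div 2) else (l, 0))"

definition halin_nodes :: "nat \<Rightarrow> (nat \<times> nat) set" where
  "halin_nodes l = insert (l, 0) {(k, i). k < l \<and> i < 3 * 2 ^ (l - Suc k)}"

definition halin_adj :: "nat \<Rightarrow> nat \<times> nat \<Rightarrow> nat \<times> nat \<Rightarrow> bool" where
  "halin_adj l x y \<longleftrightarrow>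
     fst x < l \<and> y = up l x \<or> fst y < l \<and> x = up l y \<or>
     fst x = 0 \<and> fst y = 0 \<and>
       (snd y = Suc (snd x) mod (3 * 2 ^ (l - 1)) \<or> snd x = Suc (snd y) mod (3 * 2 ^ (l - 1)))"

text \<open>
  The cycle is listed from a vertex below the child \<open>c0\<close> of the root to a vertex not below it. Then no
  set of leaves below a vertex other than the root contains both the first and the last leaf.
\<close>

locale complete_cubic_halin = complete_cubic_tree +
  fixes E C :: "'a set set" and xs :: "'a list" and p :: "'a \<Rightarrow> complex"
    and \<gamma> :: "'a set \<Rightarrow> real \<Rightarrow> complex" and c0 :: 'a
  assumes cycle: "graph_cycle V C xs" and set_xs: "set xs = leaves V T" and C: "C = cycle_edges xs"
    and E: "E = T \<union> C" and emb: "plane_embedding V E p \<gamma>"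
    and front: "frontier (exterior_face V E p \<gamma>) = edges_image \<gamma> C"
    and c0: "c0 \<in> children r" and hd_xs: "hd xs \<in> below c0" and last_xs: "last xs \<notin> below c0"
begin

definition N :: nat where "N = length xs"

lemma distinct_xs: "distinct xs" and N_ge_3: "N \<ge> 3"
  using cycle by (auto simp: graph_cycle_def N_def)

lemma N_eq: "N = 3 * 2 ^ (l - 1)"
  using card_leaves distinct_card[OF distinct_xs] set_xs by (simp add: N_def)

lemma xs_leaf: "i < N \<Longrightarrow> xs ! i \<in> leaves V T"
  using set_xs nth_mem by (auto simp: N_def)

lemma xs_V: "i < N \<Longrightarrow> xs ! i \<in> V"
  using xs_leaf leaves_in_V by blast

lemma C_leaves: "e \<in> C \<Longrightarrow> e \<subseteq> leaves V T"
proof -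
  assume "e \<in> C"
  moreover have "xs \<noteq> []" using N_ge_3 by (auto simp: N_def)
  ultimately show ?thesis
    using path_edge_subset[of e xs] set_xs hd_in_set[of xs] last_in_set[of xs]
    by (auto simp: C cycle_edges_def)
qed

lemma T_Int_C: "T \<inter> C = {}"
proof (rule ccontr)
  assume "T \<inter> C \<noteq> {}"
  then obtain e where e: "e \<in> T" "e \<in> C" by blast
  then obtain u v where uv: "e = {u, v}" using simple by (meson card_2_iff simple_graph_def)
  then have leaf: "u \<in> leaves V T" "v \<in> leaves V T" using C_leaves[OF e(2)] by auto
  then have V: "u \<in> V" "v \<in> V" using leaves_in_V by blast+
  have "{u, v} \<in> T" using e uv by simp
  then consider "u \<noteq> r" "par u = v" | "v \<noteq> r" "par v = u" using edge_par by blast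
  then show False using par(2)[OF V(1)] par(2)[OF V(2)] depth_leaf leaf by cases simp_all
qed

lemma simple_E: "simple_graph V E"
proof -
  have "card e = 2" if e: "e \<in> C" for e
  proof -
    have 3: "length xs \<ge> 3" using N_ge_3 by (simp add: N_def)
    have "xs \<noteq> []" using 3 by auto
    have "last xs \<noteq> hd xs"
      using 3 distinct_xs \<open>xs \<noteq> []\<close> by (auto simp: last_conv_nth hd_conv_nth nth_eq_iff_index_eq)
    then have "card {last xs, hd xs} = 2" by simp
    moreover have "card {xs ! i, xs ! Suc i} = 2" if "Suc i < length xs" for i
    proof -
      have "xs ! i \<noteq> xs ! Suc i" using that distinct_xs by (simp add: nth_eq_iff_index_eq)
      then show ?thesis by simp
    qed
    ultimately show ?thesis using e unfolding C cycle_edges_def path_edges_def by blast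
  qed
  then show ?thesis
    using simple C_leaves leaves_in_V unfolding E simple_graph_def by (meson UnE subset_trans)
qed

lemma finite_E: "finite E"
  using simple_E finite_V by (auto simp: simple_graph_def intro: finite_subset[of E "Pow V"])

lemma degree_E:
  assumes "v \<in> V"
  shows "degree E v = 3"
proof -
  have split: "{e \<in> E. v \<in> e} = {e \<in> T. v \<in> e} \<union> {e \<in> C. v \<in> e}" by (auto simp: E)
  have "degree E v = degree T v + card {e \<in> C. v \<in> e}"
    unfolding degree_def split
    using T_Int_C finite_E by (intro card_Un_disjoint) (auto simp: E)
  moreover have "card {e \<in> C. v \<in> e} = (if v \<in> leaves V T then 2 else 0)"
  proof (cases "v \<in> leaves V T")
    case True
    then show ?thesis
      using degree_cycle_edges[OF distinct_xs, of v] N_ge_3 set_xs by (simp add: C N_def)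
  next
    case False
    then have "{e \<in> C. v \<in> e} = {}" using C_leaves by blast
    then show ?thesis unfolding \<open>{e \<in> C. v \<in> e} = {}\<close> using False by simp
  qed
  moreover have "degree T v = (if v \<in> leaves V T then 1 else 3)"
    using degree_inner[of v] assms by (simp add: leaves_def)
  ultimately show ?thesis by simp
qed

text \<open>
  Disjoint connected parts of the tree provide disjoint tree paths between leaves. These are chords of
  the cycle: inner vertices of a tree path are not leaves, and tree edges are not cycle edges.
\<close>

lemma no_interleaving:
  assumes ord: "a < b" "b < c" "c < d" "d < N" and S: "S \<inter> S' = {}" "S \<subseteq> V" "S' \<subseteq> V"
    and mem: "xs ! a \<in> S" "xs ! b \<in> S'"
    and linked: "(xs ! a, xs ! c) \<in> (link S T)\<^sup>*" "(xs ! b, xs ! d) \<in> (link S' T)\<^sup>*"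
  shows False
proof -
  obtain P where P: "graph_path V T P" "hd P = xs ! a" "last P = xs ! c" "set P \<subseteq> S"
    using graph_path_of_link[OF linked(1) mem(1) S(2)] by blast
  obtain Q where Q: "graph_path V T Q" "hd Q = xs ! b" "last Q = xs ! d" "set Q \<subseteq> S'"
    using graph_path_of_link[OF linked(2) mem(2) S(3)] by blast
  define us where "us = take (c - Suc a) (drop (Suc a) xs)"
  define ws where "ws = drop (Suc c) xs"
  have len: "length xs = N" by (simp add: N_def)
  have "xs = take a xs @ xs ! a # drop (Suc a) xs" using id_take_nth_drop[of a xs] ord len by simp
  moreover have "drop (Suc a) xs = us @ xs ! c # ws"
    using id_take_nth_drop[of "c - Suc a" "drop (Suc a) xs"] ord len by (simp add: us_def ws_def)
  ultimately have xs: "xs = take a xs @ xs ! a # us @ xs ! c # ws" by simp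
  have b: "xs ! b \<in> set us"
    using ord len by (auto simp: us_def in_set_conv_nth intro!: exI[of _ "b - Suc a"])
  have d: "xs ! d \<in> set ws"
    using ord len by (auto simp: ws_def in_set_conv_nth intro!: exI[of _ "d - Suc c"])
  \<comment> \<open>The cycle is rotated so that it starts at the first of the four leaves.\<close>
  let ?ys = "xs ! a # us @ xs ! c # ws @ take a xs"
  have C': "C = cycle_edges ?ys"
    using cycle_edges_append_commute[of "take a xs" "xs ! a # us @ xs ! c # ws"] xs C by simp
  have "graph_cycle V E xs" using cycle unfolding graph_cycle_def E by blast
  then have cyc: "graph_cycle V E ?ys"
    using graph_cycle_append_commute[of V E "take a xs" "xs ! a # us @ xs ! c # ws"] xs by simp
  have "set xs = set (take a xs @ xs ! a # us @ xs ! c # ws)" using xs by simp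
  then have set_ys: "set ?ys = set xs" by auto
  have chord: "graph_path V E R \<and> path_edges R \<inter> C = {} \<and> set R \<inter> set ?ys = {hd R, last R}"
    if R: "graph_path V T R" "hd R \<in> leaves V T" "last R \<in> leaves V T" for R
  proof -
    have "R \<noteq> []" "path_edges R \<subseteq> T" using R(1) by (auto simp: graph_path_def)
    moreover have "set R \<inter> leaves V T = {hd R, last R}"
      using leaf_on_path[OF R(1)] R \<open>R \<noteq> []\<close> by auto
    ultimately show ?thesis using R(1) T_Int_C set_ys set_xs unfolding graph_path_def E by blast
  qed
  have "hd P \<in> leaves V T" "last P \<in> leaves V T" "hd Q \<in> leaves V T" "last Q \<in> leaves V T"
    using P Q xs_leaf ord by auto
  note PP = chord[OF P(1) this(1,2)] and QQ = chord[OF Q(1) this(3,4)]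
  show False
    by (rule no_crossing_chords[OF emb finite_V finite_E cyc C' front, of P Q "xs ! b" "xs ! d"])
      (use PP QQ P Q S b d in auto)
qed

definition anc :: "nat \<Rightarrow> nat \<Rightarrow> 'a" where
  "anc k i = (par ^^ k) (xs ! i)"

lemma depth_anc: "i < N \<Longrightarrow> depth (anc k i) = l - k"
  using depth_funpow_par[OF xs_V, of i k] depth_leaf[OF xs_leaf, of i] by (simp add: anc_def)

lemma anc_in_V: "i < N \<Longrightarrow> anc k i \<in> V"
  unfolding anc_def by (intro funpow_par_in_V xs_V)

lemma anc_Suc: "anc (Suc k) i = par (anc k i)"
  by (simp add: anc_def)

lemma anc_add: "anc (k + m) i = (par ^^ m) (anc k i)"
  unfolding anc_def add.commute[of k m] by (simp add: funpow_add)

lemma xs_below_iff: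
  assumes "i < N" "v \<in> V" "v \<noteq> r" "depth v + k = l"
  shows "xs ! i \<in> below v \<longleftrightarrow> anc k i = v"
proof
  assume "xs ! i \<in> below v"
  then obtain m where m: "anc m i = v" unfolding below_def anc_def by blast
  then have "l - m = depth v" using depth_anc[OF assms(1), of m] by simp
  moreover have "depth v \<noteq> 0" using depth_eq_0 assms by blast
  ultimately have "m = k" using assms by simp
  then show "anc k i = v" using m by simp
next
  assume "anc k i = v"
  then show "xs ! i \<in> below v" using xs_V[OF assms(1)] unfolding below_def anc_def by blast
qed

text \<open>
  The vertices below \<open>v = anc k i\<close> and the remaining vertices are both connected in the tree, so leaves
  of the two kinds do not interleave on the cycle. A gap at \<open>m\<close> between \<open>i\<close> and \<open>j\<close> would give such an
  interleaving together with the first or the last leaf, one of which is not below \<open>v\<close>.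
\<close>

lemma anc_convex:
  assumes "k < l" "i < m" "m < j" "j < N" "anc k i = anc k j"
  shows "anc k m = anc k i"
proof (rule ccontr)
  assume ne: "anc k m \<noteq> anc k i"
  define v where "v = anc k i"
  have N: "i < N" "m < N" using assms by auto
  have v: "v \<in> V" "depth v = l - k" using anc_in_V depth_anc N by (auto simp: v_def)
  then have "v \<noteq> r" using assms(1) by auto
  note iff = xs_below_iff[OF _ v(1) this, of _ k]
  have k: "depth v + k = l" using v assms by simp
  have i: "xs ! i \<in> below v" and j: "xs ! j \<in> below v" and m: "xs ! m \<notin> below v"
    using iff N assms ne k by (auto simp: v_def)
  have linked_below: "(a, b) \<in> (link (below v) T)\<^sup>*" if "a \<in> below v" "b \<in> below v" for a b
    using below_connected[OF that(1)] link_connected_sym[OF below_connected[OF that(2)]] by (rule rtrancl_trans)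
  have linked_above: "(a, b) \<in> (link (V - below v) T)\<^sup>*" if "a \<in> V - below v" "b \<in> V - below v" for a b
    using above_connected[OF that(1)] link_connected_sym[OF above_connected[OF that(2)]] by (rule rtrancl_trans)
  have sub: "below v \<subseteq> V" "below v \<inter> (V - below v) = {}" by (auto simp: below_def)
  show False
  proof (cases "xs ! 0 \<in> below v")
    case False
    then have "i \<noteq> 0" using i by metis
    then show False
      using no_interleaving[of 0 i m j "V - below v" "below v"] assms False i j m xs_V N
        linked_below linked_above sub by auto
  next
    case True
    have 0: "0 < N" "N - 1 < N" using N by auto
    have last: "xs ! (N - 1) \<notin> below v"
    proof
      assume "xs ! (N - 1) \<in> below v"
      then have "anc k 0 = anc k (N - 1)" using True iff 0 k by auto
      then have eq: "anc (l - 1) 0 = anc (l - 1) (N - 1)"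
        using anc_add[of k "l - 1 - k"] assms(1) by simp
      have c: "c0 \<in> V" "c0 \<noteq> r" "depth c0 + (l - 1) = l" using children[OF c0] l by auto
      have "xs \<noteq> []" using 0 by (auto simp: N_def)
      then have "xs ! 0 \<in> below c0" "xs ! (N - 1) \<notin> below c0"
        using hd_xs last_xs by (auto simp: hd_conv_nth last_conv_nth N_def)
      then show False using eq xs_below_iff[OF _ c] 0 by auto
    qed
    then have "j \<noteq> N - 1" using j by metis
    then have "j < N - 1" using assms(4) by linarith
    with last show False
      using no_interleaving[of i m j "N - 1" "below v" "V - below v"] assms i j m xs_V N 0
        linked_below linked_above sub by auto
  qed
qed

lemma anc_eq_iff:
  assumes "k < l" "i < N" "j < N"
  shows "anc k i = anc k j \<longleftrightarrow> i div 2 ^ k = j div 2 ^ k"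
proof (rule convex_fibres_div[OF anc_convex[OF assms(1)]])
  fix j assume j: "j < N"
  have v: "anc k j \<in> V" "anc k j \<noteq> r" "depth (anc k j) + k = l"
    using anc_in_V[OF j] depth_anc[OF j, of k] assms(1) by auto
  have "{x \<in> leaves V T. (par ^^ k) x = anc k j} = (!) xs ` {i. i < N \<and> anc k i = anc k j}"
    unfolding set_xs[symmetric] by (auto simp: set_conv_nth N_def anc_def)
  moreover have "inj_on ((!) xs) {i. i < N \<and> anc k i = anc k j}"
    using distinct_xs by (auto simp: inj_on_def N_def nth_eq_iff_index_eq)
  ultimately show "card {i. i < N \<and> anc k i = anc k j} = 2 ^ k"
    using card_leaves_below[OF v] by (simp add: card_image)
qed (use assms in auto)

lemma vertex_anc:
  assumes "v \<in> V" "v \<noteq> r"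
  obtains k i where "k < l" "i < N" "v = anc k i"
proof -
  obtain x k where x: "x \<in> leaves V T" "(par ^^ k) x = v" "depth x = depth v + k"
    using leaf_below[OF assms(1)] by blast
  then obtain i where "i < N" "x = xs ! i" using set_xs by (metis in_set_conv_nth N_def)
  moreover have "depth v \<noteq> 0" using depth_eq_0 assms by blast
  ultimately show thesis using that[of k i] x depth_leaf[OF x(1)] by (simp add: anc_def)
qed

text \<open>
  The coordinates of a vertex are read off from an arbitrary leaf below it; the choice does not matter
  by \<open>anc_eq_iff\<close>.
\<close>

definition coord :: "'a \<Rightarrow> nat \<times> nat" where
  "coord v = (if v = r then (l, 0)
     else (l - depth v, (SOME i. i < N \<and> anc (l - depth v) i = v) div 2 ^ (l - depth v)))"

lemma coord_root [simp]: "coord r = (l, 0)"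
  by (simp add: coord_def)

lemma anc_not_root:
  assumes "k < l" "i < N"
  shows "anc k i \<noteq> r"
proof
  assume "anc k i = r"
  then show False using depth_anc[OF assms(2), of k] assms(1) by simp
qed

lemma coord_anc:
  assumes "k < l" "i < N"
  shows "coord (anc k i) = (k, i div 2 ^ k)"
proof -
  define j where "j = (SOME j. j < N \<and> anc k j = anc k i)"
  have "j < N \<and> anc k j = anc k i"
    unfolding j_def by (rule someI[of _ i]) (simp add: assms)
  then have "j div 2 ^ k = i div 2 ^ k" using anc_eq_iff[OF assms(1) _ assms(2)] by blast
  moreover have "l - depth (anc k i) = k" using depth_anc[OF assms(2), of k] assms(1) by simp
  ultimately show ?thesis unfolding coord_def j_def using anc_not_root[OF assms] by simp
qed

lemma coord_inj: "inj_on coord V"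
proof (rule inj_onI)
  fix u v assume uv: "u \<in> V" "v \<in> V" "coord u = coord v"
  have root: "w = r" if wV: "w \<in> V" and wl: "fst (coord w) = l" for w
  proof (rule ccontr)
    assume "w \<noteq> r"
    then obtain k i where w: "k < l" "i < N" "w = anc k i" using vertex_anc[OF wV] by blast
    then show False using wl coord_anc[OF w(1,2)] by simp
  qed
  show "u = v"
  proof (cases "u = r \<or> v = r")
    case True
    then have "fst (coord u) = l" "fst (coord v) = l" using uv(3) coord_root by (metis fst_conv)+
    then show ?thesis using root uv by metis
  next
    case False
    obtain k i where u: "k < l" "i < N" "u = anc k i" using vertex_anc[OF uv(1)] False by blast
    obtain k' j where v: "k' < l" "j < N" "v = anc k' j" using vertex_anc[OF uv(2)] False by blast
    have "k' = k" "i div 2 ^ k = j div 2 ^ k"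
      using uv(3) coord_anc[OF u(1,2)] coord_anc[OF v(1,2)] u(3) v(3) by auto
    then show ?thesis using anc_eq_iff[OF u(1,2) v(2)] u(3) v(3) by simp
  qed
qed

lemma coord_nodes: "v \<in> V \<Longrightarrow> coord v \<in> halin_nodes l"
proof (cases "v = r")
  case False
  assume "v \<in> V"
  then obtain k i where v: "k < l" "i < N" "v = anc k i" using vertex_anc False by blast
  have "N = 3 * 2 ^ (l - Suc k) * 2 ^ k"
    using v(1) by (simp add: N_eq flip: power_add)
  then have "i div 2 ^ k < 3 * 2 ^ (l - Suc k)" using v(2) by (simp add: div_less_iff_less_mult)
  then show ?thesis using v(1) coord_anc[OF v(1,2)] by (simp add: v(3) halin_nodes_def)
qed (simp add: halin_nodes_def)

lemma coord_par:
  assumes "v \<in> V" "v \<noteq> r"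
  shows "fst (coord v) < l" "coord (par v) = up l (coord v)"
proof -
  obtain k i where v: "k < l" "i < N" "v = anc k i" using vertex_anc assms by blast
  have cv: "coord v = (k, i div 2 ^ k)" unfolding v(3) by (rule coord_anc[OF v(1,2)])
  then show "fst (coord v) < l" using v(1) by simp
  have pv: "par v = anc (Suc k) i" by (simp add: v(3) anc_Suc)
  show "coord (par v) = up l (coord v)"
  proof (cases "Suc k < l")
    case True
    have "i div 2 ^ k div 2 = i div 2 ^ Suc k" by (simp only: div_mult2_eq[symmetric] power_Suc mult.commute)
    then show ?thesis
      unfolding pv cv using True coord_anc[OF True v(2)] by (simp add: up_def)
  next
    case False
    have "depth (par v) = 0" unfolding pv using v False depth_anc[OF v(2), of "Suc k"] by simp
    then have "par v = r" using depth_eq_0 par_in_V assms(1) by blast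
    then show ?thesis unfolding cv using False by (simp add: up_def)
  qed
qed

lemma coord_leaf: "i < N \<Longrightarrow> coord (xs ! i) = (0, i)"
  using coord_anc[of 0 i] l anc_def[of 0 i] by simp

lemma coord_adj:
  assumes "{u, v} \<in> E"
  shows "halin_adj l (coord u) (coord v)"
proof (cases "{u, v} \<in> T")
  case True
  then show ?thesis
    using edge_par[OF True] coord_par[of u] coord_par[of v] edgeD[OF True]
    unfolding halin_adj_def by metis
next
  case False
  then have "{u, v} \<in> cycle_edges xs" using assms E C by auto
  moreover have "xs \<noteq> []" using N_ge_3 by (auto simp: N_def)
  moreover have "{last xs, hd xs} = {xs ! (N - 1), xs ! (Suc (N - 1) mod N)}"
    using N_ge_3 \<open>xs \<noteq> []\<close> by (simp add: last_conv_nth hd_conv_nth N_def)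
  ultimately have "\<exists>i<N. {u, v} = {xs ! i, xs ! (Suc i mod N)}"
  proof -
    assume "{u, v} \<in> cycle_edges xs" and last: "{last xs, hd xs} = {xs ! (N - 1), xs ! (Suc (N - 1) mod N)}"
    then consider "{u, v} = {last xs, hd xs}" | i where "Suc i < N" "{u, v} = {xs ! i, xs ! Suc i}"
      by (auto simp: cycle_edges_def path_edges_def N_def)
    then show ?thesis
    proof cases
      case 1
      then show ?thesis using last N_ge_3 by (intro exI[of _ "N - 1"]) auto
    next
      case 2
      then show ?thesis by (intro exI[of _ i]) auto
    qed
  qed
  then obtain i where i: "i < N" "{u, v} = {xs ! i, xs ! (Suc i mod N)}" by blast
  have "Suc i mod N < N" using N_ge_3 by simp
  then show ?thesis using i coord_leaf N_eq by (auto simp: halin_adj_def doubleton_eq_iff)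
qed

text \<open>
  The leaves 0 and 1 have the same parent, since \<open>0 div 2 = 1 div 2\<close>.
\<close>

lemma triangle: "\<exists>x y z. {x, y} \<in> E \<and> {y, z} \<in> E \<and> {z, x} \<in> E"
proof -
  have N: "0 < N" "Suc 0 < N" using N_ge_3 by auto
  have "{xs ! 0, xs ! Suc 0} \<in> C"
    using N by (auto simp: C cycle_edges_def path_edges_def N_def)
  moreover have leaf_par: "{par (xs ! i), xs ! i} \<in> T" if "i < N" for i
  proof -
    have "depth (xs ! i) \<noteq> depth r" using depth_leaf[OF xs_leaf[OF that]] l by simp
    then have "xs ! i \<noteq> r" by metis
    then show ?thesis using par(1) xs_V that by blast
  qed
  moreover have "par (xs ! 0) = par (xs ! Suc 0)"
  proof -
    have "up l (0, 0) = up l (0, Suc 0)" by (simp add: up_def)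
    then have "coord (par (xs ! 0)) = coord (par (xs ! Suc 0))"
      using coord_par[of "xs ! 0"] coord_par[of "xs ! Suc 0"] coord_leaf N xs_V depth_leaf[OF xs_leaf] l
      by (metis depth_root not_one_le_zero)
    then show ?thesis using coord_inj par_in_V xs_V N by (auto dest: inj_onD)
  qed
  ultimately have "{xs ! 0, xs ! Suc 0} \<in> E" "{xs ! Suc 0, par (xs ! 0)} \<in> E" "{par (xs ! 0), xs ! 0} \<in> E"
    using leaf_par[OF N(1)] leaf_par[OF N(2)] by (auto simp: E insert_commute)
  then show ?thesis by blast
qed

end

lemma complete_cubic_halin_coordinates:
  assumes "complete_cubic_halin_graph V E"
  obtains l coord where "l \<ge> 1" "inj_on coord V" "coord ` V \<subseteq> halin_nodes l"
    "\<And>u v. {u, v} \<in> E \<Longrightarrow> halin_adj l (coord u) (coord v)"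
    "simple_graph V E" "\<And>v. v \<in> V \<Longrightarrow> degree E v = 3"
    "\<exists>x y z. {x, y} \<in> E \<and> {y, z} \<in> E \<and> {z, x} \<in> E"
proof -
  obtain T C l where h: "cubic_halin_graph V E T C" and ct: "complete_tree V T l"
    using assms unfolding complete_cubic_halin_graph_def by blast
  then obtain r where r: "r \<in> V" "\<forall>v\<in>leaves V T. graph_dist V T r v = l" and l: "l \<ge> 1" and tr: "tree V T"
    unfolding complete_tree_def by blast
  obtain ys p \<gamma> where ys: "graph_cycle V C ys" "set ys = leaves V T" "C = cycle_edges ys"
    and E: "E = T \<union> C" and emb: "plane_embedding V E p \<gamma>"
    and front: "frontier (exterior_face V E p \<gamma>) = edges_image \<gamma> C"
    and deg: "\<forall>v\<in>V - leaves V T. degree T v = 3"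
    using h unfolding cubic_halin_graph_def halin_graph_def by blast
  interpret rooted_tree V T r by unfold_locales fact+
  interpret complete_cubic_tree V T r l
    by unfold_locales (use l r deg in \<open>auto simp: depth_def\<close>)
  have "r \<notin> leaves V T" using depth_leaf[of r] l by auto
  then have "card (children r) = 3" using degree_inner[of r] degree_children[OF root] root by simp
  then obtain c0 c1 where c: "c0 \<in> children r" "c1 \<in> children r" "c0 \<noteq> c1"
    by (metis card_3_iff insertCI)
  have leaf: "\<exists>x\<in>leaves V T. x \<in> below c" if "c \<in> children r" for c
    using leaf_below[of c] children[OF that] leaves_in_V by (auto simp: below_def)
  have disj: "x \<notin> below c1" if x0: "x \<in> below c0" for x
  proof
    assume "x \<in> below c1"
    then obtain k m where "(par ^^ k) x = c0" "(par ^^ m) x = c1" "x \<in> V"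
      using x0 unfolding below_def by blast
    moreover from this have "depth x - k = 1" "depth x - m = 1"
      using depth_funpow_par[of x k] depth_funpow_par[of x m] children c by auto
    ultimately show False using c(3) by (metis diff_diff_cancel less_imp_le_nat zero_less_diff zero_less_one)
  qed
  obtain x y where "x \<in> set ys" "x \<in> below c0" "y \<in> set ys" "y \<notin> below c0"
    using leaf[OF c(1)] leaf[OF c(2)] disj ys(2) by metis
  then obtain us vs where uv: "ys = us @ vs" "hd (vs @ us) \<in> below c0" "last (vs @ us) \<notin> below c0"
    using rotation_starting_in[of x ys "below c0" y] by blast
  interpret complete_cubic_halin V T r l E C "vs @ us" p \<gamma> c0
  proof unfold_locales
    show "graph_cycle V C (vs @ us)" using ys(1) uv(1) graph_cycle_append_commute by blast
    show "set (vs @ us) = leaves V T" using ys(2) uv(1) by auto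
    show "C = cycle_edges (vs @ us)" using ys(3) uv(1) cycle_edges_append_commute by blast
  qed fact+
  show thesis
    using that[of l coord] l coord_inj coord_nodes coord_adj simple_E degree_E triangle by blast
qed

section \<open>Edge colorings in coordinates\<close>

text \<open>
  A coloring is given by the color \<open>F k i\<close> of the edge from the node \<open>(k, i)\<close> to its parent and the color
  \<open>G i\<close> of the edge from leaf \<open>i\<close> to the next leaf. \<open>incidence\<close> lists the edges at a node as pairs of
  color and neighbor.
\<close>

definition incidence ::
  "(nat \<Rightarrow> nat \<Rightarrow> nat) \<Rightarrow> (nat \<Rightarrow> nat) \<Rightarrow> nat \<Rightarrow> nat \<times> nat \<Rightarrow> (nat \<times> nat \<times> nat) list" where
  "incidence F G l = (\<lambda>(k, i).
     if k = l then [(F (l - 1) 0, (l - 1, 0)), (F (l - 1) 1, (l - 1, 1)), (F (l - 1) 2, (l - 1, 2))]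
     else if k = 0 then
       (let N = 3 * 2 ^ (l - 1); j = (i + N - 1) mod N
        in [(F 0 i, up l (0, i)), (G i, (0, Suc i mod N)), (G j, (0, j))])
     else [(F k i, up l (k, i)), (F (k - 1) (2 * i), (k - 1, 2 * i)),
       (F (k - 1) (2 * i + 1), (k - 1, 2 * i + 1))])"

definition palette :: "(nat \<Rightarrow> nat \<Rightarrow> nat) \<Rightarrow> (nat \<Rightarrow> nat) \<Rightarrow> nat \<Rightarrow> nat \<times> nat \<Rightarrow> nat set" where
  "palette F G l x = fst ` set (incidence F G l x)"

text \<open>
  The star condition at a vertex with edges of colors \<open>a, b, c\<close>, where \<open>A, B, C\<close> are all colors at the
  respective neighbors, including the color of the edge to the vertex itself. Only the two other colors
  are looked up in each of these sets.
\<close>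

definition star_triple :: "nat \<Rightarrow> nat \<Rightarrow> nat \<Rightarrow> nat set \<Rightarrow> nat set \<Rightarrow> nat set \<Rightarrow> bool" where
  "star_triple a b c A B C \<longleftrightarrow> a \<noteq> b \<and> a \<noteq> c \<and> b \<noteq> c \<and>
     \<not> (b \<in> A \<and> a \<in> B) \<and> \<not> (c \<in> A \<and> a \<in> C) \<and> \<not> (c \<in> B \<and> b \<in> C)"

definition star_at :: "(nat \<Rightarrow> nat \<Rightarrow> nat) \<Rightarrow> (nat \<Rightarrow> nat) \<Rightarrow> nat \<Rightarrow> nat \<times> nat \<Rightarrow> bool" where
  "star_at F G l x \<longleftrightarrow>
     (case incidence F G l x of [(a, u), (b, v), (c, w)] \<Rightarrow>
       star_triple a b c (palette F G l u) (palette F G l v) (palette F G l w) | _ \<Rightarrow> False)"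

lemma star_atD:
  assumes "star_at F G l x" "(a, u) \<in> set (incidence F G l x)" "(b, w) \<in> set (incidence F G l x)" "u \<noteq> w"
  shows "a \<noteq> b" "b \<in> palette F G l u \<Longrightarrow> a \<in> palette F G l w \<Longrightarrow> False"
proof -
  have "\<exists>a1 u1 a2 u2 a3 u3. incidence F G l x = [(a1, u1), (a2, u2), (a3, u3)]"
    by (cases x; cases "fst x = l"; cases "fst x = 0") (simp_all add: incidence_def Let_def)
  then obtain a1 u1 a2 u2 a3 u3 where "incidence F G l x = [(a1, u1), (a2, u2), (a3, u3)]" by blast
  then show "a \<noteq> b" "b \<in> palette F G l u \<Longrightarrow> a \<in> palette F G l w \<Longrightarrow> False"
    using assms by (auto simp: star_at_def star_triple_def)
qed

definition node_color :: "(nat \<Rightarrow> nat \<Rightarrow> nat) \<Rightarrow> (nat \<Rightarrow> nat) \<Rightarrow> nat \<Rightarrow> nat \<times> nat \<Rightarrow> nat \<times> nat \<Rightarrow> nat" where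
  "node_color F G l = (\<lambda>(k, i) (m, j).
     if k < m then F k i else if m < k then F m j
     else if j = Suc i mod (3 * 2 ^ (l - 1)) then G i else G j)"

lemma halin_nodes_cases:
  assumes "x \<in> halin_nodes l"
  obtains "x = (l, 0)" | i where "l \<ge> 1" "x = (0, i)" "i < 3 * 2 ^ (l - 1)"
  | k i where "0 < k" "k < l" "x = (k, i)" "i < 3 * 2 ^ (l - Suc k)"
  using assms unfolding halin_nodes_def by (cases x; cases "fst x = 0") auto

lemma fst_up: "k < l \<Longrightarrow> fst (up l (k, i)) = Suc k"
  by (auto simp: up_def)

lemma node_color_up: "k < l \<Longrightarrow> node_color F G l (k, i) (up l (k, i)) = F k i"
  and node_color_up': "k < l \<Longrightarrow> node_color F G l (up l (k, i)) (k, i) = F k i"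
  using fst_up[of k l i] by (cases "up l (k, i)"; simp add: node_color_def)+

lemma cyclic_pred:
  assumes "(i::nat) < N" "j < N" "j = Suc i mod N"
  shows "(j + N - 1) mod N = i"
proof (cases "Suc i = N")
  case False
  then show ?thesis using assms by simp
qed (use assms in auto)

lemma node_color_incidence:
  assumes l: "l \<ge> 1" and xy: "x \<in> halin_nodes l" "y \<in> halin_nodes l" "halin_adj l x y"
  shows "(node_color F G l x y, y) \<in> set (incidence F G l x)"
proof -
  define N :: nat where "N = 3 * 2 ^ (l - 1)"
  have N: "N \<ge> 3" by (simp add: N_def)
  consider (up) "fst x < l" "y = up l x" | (down) "fst y < l" "x = up l y"
    | (cycle) "fst x = 0" "fst y = 0" "snd y = Suc (snd x) mod N \<or> snd x = Suc (snd y) mod N"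
    using xy(3) unfolding halin_adj_def N_def by metis
  then show ?thesis
  proof cases
    case up
    obtain k i where x: "x = (k, i)" by fastforce
    have "(F k i, up l (k, i)) \<in> set (incidence F G l (k, i))"
      using up(1) x by (auto simp: incidence_def Let_def)
    then show ?thesis using up x node_color_up[of k l F G i] by simp
  next
    case down
    obtain k i where y: "y = (k, i)" by fastforce
    have k: "k < l" and i: "i < 3 * 2 ^ (l - Suc k)"
      using down(1) xy(2) by (auto simp: y halin_nodes_def)
    have "(F k i, (k, i)) \<in> set (incidence F G l (up l (k, i)))"
    proof (cases "Suc k < l")
      case True
      have "i = 2 * (i div 2) \<or> i = 2 * (i div 2) + 1" by presburger
      then show ?thesis using True by (auto simp: incidence_def up_def)
    next
      case False
      then have "Suc k = l" using k by simp
      then have "i \<in> {0, 1, 2}" using i by auto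
      then show ?thesis using False \<open>Suc k = l\<close> by (auto simp: incidence_def up_def)
    qed
    then show ?thesis using down y node_color_up'[OF k, of F G i] by simp
  next
    case cycle
    obtain i j where x: "x = (0, i)" and y: "y = (0, j)" using cycle by (metis prod.collapse)
    have ij: "i < N" "j < N" using xy l by (auto simp: x y halin_nodes_def N_def)
    have inc: "set (incidence F G l x) =
        {(F 0 i, up l (0, i)), (G i, (0, Suc i mod N)), (G ((i + N - 1) mod N), (0, (i + N - 1) mod N))}"
      using l by (simp add: x incidence_def Let_def N_def)
    show ?thesis
    proof (cases "j = Suc i mod N")
      case True
      then have "node_color F G l x y = G i" by (simp add: x y node_color_def N_def)
      then show ?thesis unfolding inc y using True by simp
    next
      case False
      then have "i = Suc j mod N" using cycle x y by simp
      then have "j = (i + N - 1) mod N" using cyclic_pred ij by metis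
      moreover have "node_color F G l x y = G j" using False by (simp add: x y node_color_def N_def)
      ultimately show ?thesis unfolding inc y by simp
    qed
  qed
qed

lemma node_color_sym:
  assumes xy: "x \<in> halin_nodes l" "y \<in> halin_nodes l" "halin_adj l x y" "l \<ge> 1"
  shows "node_color F G l x y = node_color F G l y x"
proof -
  obtain k i m j where x: "x = (k, i)" and y: "y = (m, j)" by fastforce
  show ?thesis
  proof (cases "k = m")
    case False
    then show ?thesis by (auto simp: x y node_color_def)
  next
    case True
    define N :: nat where "N = 3 * 2 ^ (l - 1)"
    have N: "N \<ge> 3" by (simp add: N_def)
    have up_ne: "up l (k, a) \<noteq> (k, b)" if "k < l" for a b
      using fst_up[OF that, of a] by (metis fst_conv n_not_Suc_n)
    have adj: "k = 0" "j = Suc i mod N \<or> i = Suc j mod N"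
      using xy(3) True up_ne[of i j] up_ne[of j i] by (auto simp: x y halin_adj_def N_def)
    then have ij: "i < N" "j < N" using xy True by (auto simp: x y halin_nodes_def N_def)
    have "\<not> (j = Suc i mod N \<and> i = Suc j mod N)"
      using ij N by (auto simp: mod_Suc split: if_splits)
    moreover have "node_color F G l x y = (if j = Suc i mod N then G i else G j)"
      "node_color F G l y x = (if i = Suc j mod N then G j else G i)"
      by (simp_all add: x y True node_color_def N_def)
    ultimately show ?thesis using adj by auto
  qed
qed

text \<open>
  Coordinates are injective and send edges to edges of the model, so a violation of the star condition
  in the graph is one in the model.
\<close>

lemma star_edge_coloring_from_coordinates:
  assumes l: "l \<ge> 1" and inj: "inj_on coord V" and nodes: "coord ` V \<subseteq> halin_nodes l"
    and adj: "\<And>u v. {u, v} \<in> E \<Longrightarrow> halin_adj l (coord u) (coord v)"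
    and simple: "simple_graph V E"
    and star: "\<And>x. x \<in> halin_nodes l \<Longrightarrow> star_at F G l x"
    and range: "\<And>k i. F k i \<in> {1..n}" "\<And>i. G i \<in> {1..n}"
  shows "\<exists>c. star_edge_coloring V E n c"
proof -
  \<comment> \<open>Either order of the two ends gives the same color, by \<open>node_color_sym\<close>.\<close>
  define c where "c e = (SOME z. \<exists>u v. e = {u, v} \<and> z = node_color F G l (coord u) (coord v))" for e
  note edgeD = simple_graph_edgeD[OF simple]
  have node: "coord v \<in> halin_nodes l" if "v \<in> V" for v using nodes that by blast
  have c: "c {u, v} = node_color F G l (coord u) (coord v)" if e: "{u, v} \<in> E" for u v
  proof -
    have "\<exists>u' v'. {u, v} = {u', v'} \<and> c {u, v} = node_color F G l (coord u') (coord v')"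
      unfolding c_def by (rule someI_ex) blast
    then show ?thesis
      using node_color_sym[OF node node adj[OF e] l] edgeD[OF e] by (auto simp: doubleton_eq_iff)
  qed
  have inc: "(c {v, u}, coord u) \<in> set (incidence F G l (coord v))" if e: "{v, u} \<in> E" for v u
    using node_color_incidence[OF l node node adj[OF e]] edgeD[OF e] c[OF e] by simp
  have "star_edge_coloring V E n c"
  proof (rule star_edge_coloringI[OF simple])
    show "c ` E \<subseteq> {1..n}"
    proof
      fix z assume "z \<in> c ` E"
      then obtain e where e: "e \<in> E" "z = c e" by blast
      then obtain u v where "e = {u, v}" using simple unfolding simple_graph_def by (meson card_2_iff)
      then have "z = node_color F G l (coord u) (coord v)" using c e by simp
      then show "z \<in> {1..n}" using range by (simp add: node_color_def split: prod.splits)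
    qed
  next
    fix v u w assume e: "{v, u} \<in> E" "{v, w} \<in> E" "u \<noteq> w"
    have star_v: "star_at F G l (coord v)" using star node edgeD[OF e(1)] by blast
    have ne: "coord u \<noteq> coord w" using inj edgeD[OF e(1)] edgeD[OF e(2)] e(3) by (auto dest: inj_onD)
    show "c {v, u} \<noteq> c {v, w}" by (rule star_atD(1)[OF star_v inc[OF e(1)] inc[OF e(2)] ne])
    fix x y assume f: "{u, x} \<in> E" "{w, y} \<in> E" "c {u, x} = c {v, w}" "c {w, y} = c {v, u}"
    have "c {v, w} \<in> palette F G l (coord u)" "c {v, u} \<in> palette F G l (coord w)"
      using inc[OF f(1)] inc[OF f(2)] f(3,4) unfolding palette_def by (metis fst_conv image_eqI)+
    then show False by (rule star_atD(2)[OF star_v inc[OF e(1)] inc[OF e(2)] ne])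
  qed
  then show ?thesis by blast
qed

section \<open>A star 5-edge coloring by periodic words\<close>

definition swap_color :: "nat \<Rightarrow> nat" where
  "swap_color c = (if c = 1 then 2 else if c = 2 then 1 else c)"

text \<open>
  The period 12 in the index fits both the tree and the cycle: the residues modulo 12 of \<open>2 * i\<close> and
  \<open>2 * i + 1\<close> depend on that of \<open>i\<close> only, and 12 divides the number of leaves for \<open>l \<ge> 3\<close>. For
  colorings of this form the star conditions are a finite system of constraints on the words; these
  words are one of its solutions.
\<close>

fun tree_color :: "nat \<Rightarrow> nat \<Rightarrow> nat" where
  "tree_color 0 i = [2, 1, 5, 1, 2, 5, 2, 4, 5, 4, 1, 4] ! (i mod 12)"
| "tree_color (Suc 0) i = [4, 2, 3, 5, 2, 3, 4, 2, 3, 1, 1, 3] ! (i mod 12)"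
| "tree_color (Suc (Suc 0)) i = [3, 1, 5, 3, 4, 2, 3, 1, 1, 5, 5, 2] ! (i mod 12)"
| "tree_color (Suc (Suc (Suc 0))) i = [2, 1, 5, 2, 4, 1, 4, 1, 5, 4, 4, 1] ! (i mod 12)"
| "tree_color (Suc (Suc (Suc (Suc k)))) i = swap_color (tree_color (Suc k) i)"

definition cycle_color :: "nat \<Rightarrow> nat" where
  "cycle_color i = [3, 4, 3, 5, 4, 1, 5, 3, 1, 2, 5, 1] ! (i mod 12)"

lemma tree_color_add_3:
  assumes "k \<ge> 1"
  shows "tree_color (k + 3) i = swap_color (tree_color k i)"
proof -
  obtain m where k: "k = Suc m" using assms by (cases k) auto
  have "k + 3 = Suc (Suc (Suc (Suc m)))" by (simp add: k)
  then show ?thesis by (simp only: k tree_color.simps(5))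
qed

lemma inj_swap_color: "inj swap_color"
proof -
  have "swap_color (swap_color c) = c" for c by (simp add: swap_color_def)
  then show ?thesis by (rule inj_on_inverseI)
qed

lemma nth_mod_12: "list_all P xs \<Longrightarrow> length xs = 12 \<Longrightarrow> P (xs ! (i mod 12))"
  by (simp add: list_all_length)

lemma swap_color_range: "c \<in> {1..5} \<Longrightarrow> swap_color c \<in> {1..5}"
  by (auto simp: swap_color_def)

lemma tree_color_range: "tree_color k i \<in> {1..5}"
proof (induction k i rule: tree_color.induct)
  case (5 k i)
  then show ?case unfolding tree_color.simps(5) by (rule swap_color_range)
qed (unfold tree_color.simps, (rule nth_mod_12[where P = "\<lambda>c. c \<in> {1..5}"], simp, simp)+)

lemma cycle_color_range: "cycle_color i \<in> {1..5}"
  unfolding cycle_color_def by (rule nth_mod_12[where P = "\<lambda>c. c \<in> {1..5}"], simp, simp)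

lemma tree_color_mod_12: "tree_color k (i mod 12) = tree_color k i"
  by (induction k i rule: tree_color.induct) (simp_all only: tree_color.simps mod_mod_trivial)

lemma tree_color_cong: "i mod 12 = j mod 12 \<Longrightarrow> tree_color k i = tree_color k j"
  using tree_color_mod_12[of k i] tree_color_mod_12[of k j] by simp

lemma cycle_color_cong:
  assumes "i mod 12 = j mod 12"
  shows "cycle_color i = cycle_color j"
  unfolding cycle_color_def assms ..

definition inner_palette :: "nat \<Rightarrow> nat \<Rightarrow> nat set" where
  "inner_palette k i =
     {tree_color k i, tree_color (k - 1) (2 * i), tree_color (k - 1) (2 * i + 1)}"

text \<open>
  The color of the cycle edge before leaf \<open>i\<close> is written \<open>cycle_color (i + 11)\<close>, which avoids the
  subtraction \<open>i - 1\<close> at \<open>i = 0\<close> and is the same residue modulo 12.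
\<close>

definition leaf_palette :: "nat \<Rightarrow> nat set" where
  "leaf_palette i = {tree_color 0 i, cycle_color i, cycle_color (i + 11)}"

lemma inner_palette_cong:
  assumes "i mod 12 = j mod 12"
  shows "inner_palette k i = inner_palette k j"
proof -
  have "2 * i mod 12 = 2 * j mod 12" using assms by (rule mod_mult_cong[OF refl])
  moreover from this have "(2 * i + 1) mod 12 = (2 * j + 1) mod 12" by (rule mod_add_cong) simp
  ultimately have "2 * i mod 12 = 2 * j mod 12" "(2 * i + 1) mod 12 = (2 * j + 1) mod 12" .
  from this[THEN tree_color_cong] show ?thesis
    unfolding inner_palette_def by (simp only: tree_color_cong[OF assms])
qed

lemma leaf_palette_cong:
  assumes "i mod 12 = j mod 12"
  shows "leaf_palette i = leaf_palette j"
proof -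
  have "(i + 11) mod 12 = (j + 11) mod 12" using assms by (rule mod_add_cong) simp
  from this[THEN cycle_color_cong] show ?thesis
    unfolding leaf_palette_def by (simp only: tree_color_cong[OF assms] cycle_color_cong[OF assms])
qed

lemma inner_palette_add_3: "k \<ge> 2 \<Longrightarrow> inner_palette (k + 3) i = swap_color ` inner_palette k i"
proof -
  assume k: "k \<ge> 2"
  then have "k + 3 - 1 = k - 1 + 3" "1 \<le> k" "1 \<le> k - 1" by simp_all
  then show ?thesis
    unfolding inner_palette_def by (simp only: tree_color_add_3 image_insert image_empty)
qed

lemma star_triple_inj:
  "inj f \<Longrightarrow> star_triple (f a) (f b) (f c) (f ` A) (f ` B) (f ` C) \<longleftrightarrow> star_triple a b c A B C"
  by (simp add: star_triple_def inj_eq inj_image_mem_iff)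

lemma induct_step_3:
  assumes "\<And>k. n \<le> k \<Longrightarrow> k < n + 3 \<Longrightarrow> P k" "\<And>k. n \<le> k \<Longrightarrow> P k \<Longrightarrow> P (k + 3)" "n \<le> (k::nat)"
  shows "P k"
  using assms(3)
proof (induction k rule: less_induct)
  case (less k)
  show ?case
  proof (cases "k < n + 3")
    case False
    then have "P (k - 3)" using less by simp
    then show ?thesis using assms(2)[of "k - 3"] False by simp
  next
    case True
    then show ?thesis using assms(1) less.prems by blast
  qed
qed

text \<open>
  The star conditions at the five kinds of nodes: nodes whose children and parent are inner nodes, with
  two or more levels below them (\<open>inner_star\<close>); the same for children of the root (\<open>top_star\<close>); the
  root; parents of leaves (\<open>fork_star\<close>); and leaves.
\<close>

definition inner_star :: "nat \<Rightarrow> nat \<Rightarrow> bool" where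
  "inner_star k i \<longleftrightarrow>
     star_triple (tree_color k i) (tree_color (k - 1) (2 * i)) (tree_color (k - 1) (2 * i + 1))
       (inner_palette (k + 1) (i div 2)) (inner_palette (k - 1) (2 * i)) (inner_palette (k - 1) (2 * i + 1))"

definition top_star :: "nat \<Rightarrow> nat \<Rightarrow> bool" where
  "top_star k i \<longleftrightarrow>
     star_triple (tree_color k i) (tree_color (k - 1) (2 * i)) (tree_color (k - 1) (2 * i + 1))
       {tree_color k 0, tree_color k 1, tree_color k 2}
       (inner_palette (k - 1) (2 * i)) (inner_palette (k - 1) (2 * i + 1))"

definition root_star :: "nat \<Rightarrow> bool" where
  "root_star k \<longleftrightarrow>
     star_triple (tree_color k 0) (tree_color k 1) (tree_color k 2)
       (inner_palette k 0) (inner_palette k 1) (inner_palette k 2)"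

definition fork_star :: "nat \<Rightarrow> bool" where
  "fork_star i \<longleftrightarrow>
     star_triple (tree_color 1 i) (tree_color 0 (2 * i)) (tree_color 0 (2 * i + 1))
       (inner_palette 2 (i div 2)) (leaf_palette (2 * i)) (leaf_palette (2 * i + 1))"

definition leaf_star :: "nat \<Rightarrow> bool" where
  "leaf_star i \<longleftrightarrow>
     star_triple (tree_color 0 i) (cycle_color i) (cycle_color (i + 11))
       (inner_palette 1 (i div 2)) (leaf_palette (i + 1)) (leaf_palette (i + 11))"

text \<open>
  The parent of node \<open>i\<close> has number \<open>i div 2\<close>, whose residue modulo 12 depends on \<open>i mod 24\<close>.
\<close>

lemma mod_24:
  fixes i :: nat
  shows "i mod 24 mod 12 = i mod 12" "i mod 24 div 2 mod 12 = i div 2 mod 12"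
    "2 * (i mod 24) mod 12 = 2 * i mod 12" "(2 * (i mod 24) + 1) mod 12 = (2 * i + 1) mod 12"
    "(i mod 24 + 1) mod 12 = (i + 1) mod 12" "(i mod 24 + 11) mod 12 = (i + 11) mod 12"
proof -
  show 12: "i mod 24 mod 12 = i mod 12" by (rule mod_mod_cancel) simp
  show "i mod 24 div 2 mod 12 = i div 2 mod 12" using mod_mult2_eq[of i 2 12] by simp
  show 2: "2 * (i mod 24) mod 12 = 2 * i mod 12" using 12 by (rule mod_mult_cong[OF refl])
  show "(2 * (i mod 24) + 1) mod 12 = (2 * i + 1) mod 12" using 2 by (rule mod_add_cong) simp
  show "(i mod 24 + 1) mod 12 = (i + 1) mod 12" "(i mod 24 + 11) mod 12 = (i + 11) mod 12"
    using 12 by (rule mod_add_cong, simp)+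
qed

text \<open>
  The word for the leaves is not part of the periodic pattern. Hence the periodicity starts at \<open>k = 3\<close>
  for the conditions that look two levels down, and at \<open>k = 2\<close> for the root condition; the checked
  heights are one period and the single height before it.
\<close>

lemma inner_star_base: "list_all (\<lambda>k. list_all (inner_star k) [0..<24]) [2, 3, 4, 5]"
  by code_simp

lemma top_star_base: "list_all (\<lambda>k. list_all (top_star k) [0..<3]) [2, 3, 4, 5]"
  by code_simp

lemma root_star_base: "list_all root_star [1, 2, 3, 4]"
  by code_simp

lemma fork_star_base: "list_all fork_star [0..<24]"
  by code_simp

lemma leaf_star_base: "list_all leaf_star [0..<24]"
  by code_simp

lemma inner_star:
  assumes "k \<ge> 2"
  shows "inner_star k i"
proof -
  have small: "inner_star m i" if "2 \<le> m" "m < 6" for m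
  proof -
    have "m = 2 \<or> m = 3 \<or> m = 4 \<or> m = 5" using that by linarith
    then have "inner_star m (i mod 24)" using inner_star_base by (auto simp: list_all_iff)
    then show ?thesis
      by (simp only: inner_star_def mod_24[THEN tree_color_cong] mod_24[THEN inner_palette_cong])
  qed
  show ?thesis
  proof (cases "k = 2")
    case False
    have "3 \<le> k" using False assms by simp
    then show ?thesis
    proof (rule induct_step_3[rotated 2])
      fix m :: nat assume m: "3 \<le> m" and IH: "inner_star m i"
      have e: "m + 3 + 1 = m + 1 + 3" "m + 3 - 1 = m - 1 + 3"
        and ge: "1 \<le> m" "1 \<le> m - 1" "2 \<le> m + 1" "2 \<le> m - 1" using m by simp_all
      show "inner_star (m + 3) i"
        using IH unfolding inner_star_def e
        by (simp only: inner_palette_add_3 tree_color_add_3 star_triple_inj[OF inj_swap_color] ge)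
    qed (use small in auto)
  qed (use small in simp)
qed

lemma top_star:
  assumes "k \<ge> 2" "i < 3"
  shows "top_star k i"
proof -
  have small: "top_star m i" if "2 \<le> m" "m < 6" for m
  proof -
    have "m = 2 \<or> m = 3 \<or> m = 4 \<or> m = 5" using that by linarith
    then show ?thesis using top_star_base assms(2) by (auto simp: list_all_iff)
  qed
  show ?thesis
  proof (cases "k = 2")
    case False
    have "3 \<le> k" using False assms by simp
    then show ?thesis
    proof (rule induct_step_3[rotated 2])
      fix m :: nat assume m: "3 \<le> m" and IH: "top_star m i"
      have e: "m + 3 - 1 = m - 1 + 3"
        and ge: "1 \<le> m" "1 \<le> m - 1" "2 \<le> m - 1" using m by simp_all
      have top: "{swap_color (tree_color m 0), swap_color (tree_color m 1), swap_color (tree_color m 2)} =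
          swap_color ` {tree_color m 0, tree_color m 1, tree_color m 2}"
        by (simp only: image_insert image_empty)
      show "top_star (m + 3) i"
        using IH unfolding top_star_def e
        by (simp only: inner_palette_add_3 tree_color_add_3 top star_triple_inj[OF inj_swap_color] ge)
    qed (use small in auto)
  qed (use small in simp)
qed

lemma root_star:
  assumes "k \<ge> 1"
  shows "root_star k"
proof -
  have small: "root_star m" if "1 \<le> m" "m < 5" for m
  proof -
    have "m = 1 \<or> m = 2 \<or> m = 3 \<or> m = 4" using that by linarith
    then show ?thesis using root_star_base by (auto simp: list_all_iff)
  qed
  show ?thesis
  proof (cases "k = 1")
    case False
    have "2 \<le> k" using False assms by simp
    then show ?thesis
    proof (rule induct_step_3[rotated 2])
      fix m :: nat assume m: "2 \<le> m" and IH: "root_star m"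
      have ge: "1 \<le> m" using m by simp
      show "root_star (m + 3)"
        using IH unfolding root_star_def
        by (simp only: inner_palette_add_3[OF m] tree_color_add_3 star_triple_inj[OF inj_swap_color] ge)
    qed (use small in auto)
  qed (use small in simp)
qed

lemma fork_star: "fork_star i"
proof -
  have "fork_star (i mod 24)" using fork_star_base by (auto simp: list_all_iff)
  then show ?thesis
    by (simp only: fork_star_def mod_24[THEN tree_color_cong] mod_24[THEN inner_palette_cong]
        mod_24[THEN leaf_palette_cong])
qed

lemma leaf_star: "leaf_star i"
proof -
  have "leaf_star (i mod 24)" using leaf_star_base by (auto simp: list_all_iff)
  then show ?thesis
    by (simp only: leaf_star_def mod_24[THEN tree_color_cong] mod_24[THEN inner_palette_cong]
        mod_24[THEN leaf_palette_cong] mod_24[THEN cycle_color_cong])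
qed

lemma palette_inner:
  "0 < k \<Longrightarrow> k < l \<Longrightarrow> palette tree_color cycle_color l (k, i) = inner_palette k i"
  by (simp add: palette_def incidence_def inner_palette_def)

lemma palette_root:
  "palette tree_color cycle_color l (l, 0) =
    {tree_color (l - 1) 0, tree_color (l - 1) 1, tree_color (l - 1) 2}"
  by (simp add: palette_def incidence_def)

lemma cyclic_mod_12:
  assumes "l \<ge> 3" and N: "N = 3 * 2 ^ (l - 1)"
  shows "Suc i mod N mod 12 = (i + 1) mod 12" "(i + N - 1) mod N mod 12 = (i + 11) mod 12"
proof -
  have "l - 1 = 2 + (l - 3)" using assms(1) by simp
  then have m: "N = 12 * 2 ^ (l - 3)" unfolding N by (simp only: power_add) simp
  then have dvd: "12 dvd N" by simp
  obtain q where "(2::nat) ^ (l - 3) = Suc q" by (metis not0_implies_Suc power_not_zero zero_neq_numeral)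
  then have "i + N - 1 = i + 11 + 12 * q" unfolding m by simp
  then have "(i + N - 1) mod 12 = (i + 11) mod 12" by (simp only: mod_mult_self2)
  then show "(i + N - 1) mod N mod 12 = (i + 11) mod 12" by (simp only: mod_mod_cancel[OF dvd])
  show "Suc i mod N mod 12 = (i + 1) mod 12" by (simp add: mod_mod_cancel[OF dvd])
qed

lemma palette_leaf:
  assumes "l \<ge> 3"
  shows "palette tree_color cycle_color l (0, i) = leaf_palette i"
proof -
  note e = cyclic_mod_12(2)[OF assms refl, THEN cycle_color_cong, of i]
  have "l \<noteq> 0" using assms by simp
  then show ?thesis
    unfolding leaf_palette_def by (simp add: palette_def incidence_def Let_def e[symmetric])
qed

lemma star_at_tree_color:
  assumes l: "l \<ge> 3" and x: "x \<in> halin_nodes l"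
  shows "star_at tree_color cycle_color l x"
  using x
proof (cases rule: halin_nodes_cases)
  case 1
  then show ?thesis
    using root_star[of "l - 1"] l
    by (simp add: star_at_def incidence_def palette_inner root_star_def)
next
  case (2 i)
  define N :: nat where "N = 3 * 2 ^ (l - 1)"
  note e = cyclic_mod_12[OF l N_def, of i]
  have "up l (0, i) = (1, i div 2)" using l by (simp add: up_def)
  moreover have "incidence tree_color cycle_color l (0, i) = [(tree_color 0 i, up l (0, i)),
     (cycle_color i, (0, Suc i mod N)), (cycle_color ((i + N - 1) mod N), (0, (i + N - 1) mod N))]"
    using l by (simp add: incidence_def Let_def N_def)
  moreover have "palette tree_color cycle_color l (1, i div 2) = inner_palette 1 (i div 2)"
    using l by (intro palette_inner) auto
  ultimately show ?thesis
    using leaf_star[of i] unfolding 2(2) leaf_star_def star_at_def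
    by (simp only: list.case prod.case palette_leaf[OF l] e[THEN leaf_palette_cong]
        e(2)[THEN cycle_color_cong])
next
  case (3 k i)
  have inc: "incidence tree_color cycle_color l (k, i) = [(tree_color k i, up l (k, i)),
     (tree_color (k - 1) (2 * i), (k - 1, 2 * i)), (tree_color (k - 1) (2 * i + 1), (k - 1, 2 * i + 1))]"
    using 3 by (simp add: incidence_def)
  show ?thesis
  proof (cases "k = 1")
    case True
    have "up l (k, i) = (2, i div 2)" using True l by (simp add: up_def)
    moreover have "palette tree_color cycle_color l (2, i div 2) = inner_palette 2 (i div 2)"
      using l by (intro palette_inner) auto
    ultimately show ?thesis
      using fork_star[of i] True unfolding 3(3) star_at_def inc fork_star_def
      by (simp add: palette_leaf[OF l])
  next
    case False
    then have k: "k \<ge> 2" "0 < k - 1" "k - 1 < l" using 3 by auto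
    show ?thesis
    proof (cases "Suc k < l")
      case True
      have "up l (k, i) = (k + 1, i div 2)" using True by (simp add: up_def)
      moreover have "palette tree_color cycle_color l (k + 1, i div 2) = inner_palette (k + 1) (i div 2)"
        using True by (intro palette_inner) auto
      ultimately show ?thesis
        using inner_star[OF k(1), of i] unfolding 3(3) star_at_def inc inner_star_def
        by (simp only: palette_inner[OF k(2,3)] list.case prod.case)
    next
      case False
      then have kl: "l - 1 = k" "Suc k = l" using 3 by auto
      then have "i < 3" using 3(4) by auto
      moreover have "up l (k, i) = (l, 0)" using False by (simp add: up_def)
      ultimately show ?thesis
        using top_star[OF k(1), of i] unfolding 3(3) star_at_def inc top_star_def
        by (simp only: palette_inner[OF k(2,3)] palette_root kl list.case prod.case)
    qed
  qed
qed

text \<open>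
  With six leaves the words of length 12 are cut in half, so the condition around the last leaf is not
  an instance of the periodic one.
\<close>

lemma star_at_two_levels:
  assumes "x \<in> halin_nodes 2"
  shows "star_at tree_color cycle_color 2 x"
proof -
  have "list_all (star_at tree_color cycle_color 2)
      ((2, 0) # map (Pair 0) [0..<6] @ map (Pair 1) [0..<3])"
    by code_simp
  moreover have "x \<in> set ((2, 0) # map (Pair 0) [0..<6] @ map (Pair 1) [0..<3])"
    using assms by (cases rule: halin_nodes_cases) (auto simp: less_2_cases_iff)
  ultimately show ?thesis unfolding list_all_iff by blast
qed

text \<open>
  With one level, only two opposite edges of \<open>K\<^sub>4\<close> share a color, namely the edge from the root to
  leaf 2 and the cycle edge from leaf 0 to leaf 1, both of color 3; four edges never carry only two
  colors.
\<close>

definition K4_tree_color :: "nat \<Rightarrow> nat \<Rightarrow> nat" where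
  "K4_tree_color k i = i mod 3 + 1"

definition K4_cycle_color :: "nat \<Rightarrow> nat" where
  "K4_cycle_color i = i mod 3 + 3"

lemma star_at_one_level:
  assumes "x \<in> halin_nodes 1"
  shows "star_at K4_tree_color K4_cycle_color 1 x"
proof -
  have "list_all (star_at K4_tree_color K4_cycle_color 1) [(1, 0), (0, 0), (0, 1), (0, 2)]"
    by code_simp
  moreover have "x \<in> set [(1, 0), (0, 0), (0, 1), (0, 2)]"
    using assms by (cases rule: halin_nodes_cases) auto
  ultimately show ?thesis unfolding list_all_iff by blast
qed

lemma halin_star_at_ex:
  assumes "l \<ge> 1"
  shows "\<exists>F G. (\<forall>x\<in>halin_nodes l. star_at F G l x) \<and> (\<forall>k i. F k i \<in> {1..5}) \<and> (\<forall>i. G i \<in> {1..5})"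
proof (cases "l = 1")
  case True
  have "K4_tree_color k i \<in> {1..5}" "K4_cycle_color i \<in> {1..5}" for k i
    using mod_less_divisor[of 3 i] unfolding K4_tree_color_def K4_cycle_color_def atLeastAtMost_iff
    by linarith+
  then show ?thesis using star_at_one_level True by blast
next
  case False
  have "star_at tree_color cycle_color l x" if "x \<in> halin_nodes l" for x
  proof (cases "l = 2")
    case True
    then show ?thesis using star_at_two_levels that by simp
  next
    case l2: False
    then have "l \<ge> 3" using False assms by linarith
    then show ?thesis using that by (rule star_at_tree_color)
  qed
  then show ?thesis using tree_color_range cycle_color_range by blast
qed

section \<open>The star chromatic index\<close>

theorem theorem3p2:
  fixes V :: "'a set" and E :: "'a set set"
  assumes "complete_cubic_halin_graph V E"
  shows "star_chromatic_index V E = 5"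
proof -
  obtain l coord where l: "l \<ge> 1" and coord: "inj_on coord V" "coord ` V \<subseteq> halin_nodes l"
      "\<And>u v. {u, v} \<in> E \<Longrightarrow> halin_adj l (coord u) (coord v)"
    and simple: "simple_graph V E" and degree: "\<And>v. v \<in> V \<Longrightarrow> degree E v = 3"
    and triangle: "\<exists>x y z. {x, y} \<in> E \<and> {y, z} \<in> E \<and> {z, x} \<in> E"
    using complete_cubic_halin_coordinates[OF assms] by metis
  obtain F G where FG: "\<And>x. x \<in> halin_nodes l \<Longrightarrow> star_at F G l x"
    "\<And>k i. F k i \<in> {1..5}" "\<And>i. G i \<in> {1..5}"
    using halin_star_at_ex[OF l] by metis
  have "\<exists>c. star_edge_coloring V E 5 c"
    by (rule star_edge_coloring_from_coordinates[OF l coord simple FG])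
  moreover have "5 \<le> k" if "star_edge_coloring V E k c" for k c
    using star_edge_coloring_triangle_ge_5[OF simple that degree] triangle by blast
  ultimately show ?thesis
    unfolding star_chromatic_index_def by (intro Least_equality) auto
qed

end
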